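(* Let $(M,P,g)$ be a $\mathcal{W}_1$-manifold with $\dim M=2n$, let $\nabla$ be the Levi-Civita connection of $g$, and let $\nabla'$ be the natural connection determined by the pair of real parameters $(\lambda,\mu)$. The curvature tensor $R'$ of $\nabla'$ is a Riemannian $P$-tensor if and only if the following conditions hold for all $y,z$: $$\lambda\{(\nabla_y\theta)z-(\nabla_z\theta)y\}+\left(\mu+\tfrac1{2n}\right)\{(\nabla_y\theta)Pz-(\nabla_z\theta)Py\}=0,$$ $$\mu\{(\nabla_y\theta)z-(\nabla_z\theta)y\}+\lambda\{(\nabla_y\theta)Pz-(\nabla_z\theta)Py\}=0.$$
   Context: Setting. A Riemannian almost product manifold $(M,P,g)$ is a differentiable manifold $M$ with a $(1,1)$-tensor field $P$ and a Riemannian metric $g$ such that $P^2x=x$ and $g(Px,Py)=g(x,y)$. Throughout $\operatorname{tr}P=0$ and $\dim M=2n$; $x,y,z,w$ are arbitrary smooth vector fields (or tangent vectors). Let $\nabla$ be the Levi-Civita connection of $g$, $F(x,y,z)=g((\nabla_xP)y,z)$, and $\theta(x)=g^{ij}F(e_i,e_j,x)$, where $\{e_i\}$ is a basis of the tangent space and $(g^{ij})$ is the inverse matrix of $(g(e_i,e_j))$. $(M,P,g)$ is a $\mathcal{W}_1$-manifold if $$F(x,y,z)=\tfrac{1}{2n}\{g(x,y)\theta(z)-g(x,Py)\theta(Pz)+g(x,z)\theta(y)-g(x,Pz)\theta(Py)\}.$$ The vector field $\Omega$ is defined by $g(\Omega,x)=\theta(x)$. Natural connections. A linear connection $\nabla'$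 is natural if $\nabla'P=\nabla'g=0$. The natural connections considered on a $\mathcal{W}_1$-manifold form a 2-parametric family with parameters $\lambda,\mu\in\mathbb{R}$; the one determined by $(\lambda,\mu)$ is $$\nabla'_xy=\nabla_xy+g(x,Py)\{\lambda P\Omega+\mu\Omega\}-\{\lambda\theta(Py)+\mu\theta(y)\}Px+g(x,y)\{\lambda\Omega+(\mu+\tfrac1{2n})P\Omega\}-\{\lambda\theta(y)+(\mu+\tfrac1{2n})\theta(Py)\}x.$$ Curvature. $R'(x,y)z=\nabla'_x\nabla'_yz-\nabla'_y\nabla'_xz-\nabla'_{[x,y]}z$, $R'(x,y,z,w)=g(R'(x,y)z,w)$. A $(0,4)$-tensor $L$ is a Riemannian $P$-tensor if $L(x,y,z,w)=-L(y,x,z,w)=-L(x,y,w,z)$, $L(x,y,z,w)+L(y,z,x,w)+L(z,x,y,w)=0$, and $L(x,y,Pz,Pw)=L(x,y,z,w)$.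
   Formalization: Assumes n ≥ 2 (dim M ≥ 4). For n = 1 the claim is false: R' = 0 is always a Riemannian P-tensor, but on R^2 with g = e^{2xy}dx^2 + dy^2, P = diag(1,-1), λ = μ = 0, the first condition fails. *)

theory Defs
  imports "HOL-Analysis.Analysis"
begin

section \<open>Smooth manifolds\<close>

text \<open>Membership in the class of \<open>k\<close> times continuously differentiable maps, intended for open sets.\<close>

fun Ck_on :: "nat \<Rightarrow> ('a::euclidean_space \<Rightarrow> 'b::real_normed_vector) \<Rightarrow> 'a set \<Rightarrow> bool" where
  "Ck_on 0 f S \<longleftrightarrow> continuous_on S f"
| "Ck_on (Suc k) f S \<longleftrightarrow>
     f differentiable_on S \<and> (\<forall>v. Ck_on k (\<lambda>x. frechet_derivative f (at x) v) S)"

definition smooth_on :: "'a::euclidean_space set \<Rightarrow> ('a \<Rightarrow> 'b::real_normed_vector) \<Rightarrow> bool" where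
  "smooth_on S f \<longleftrightarrow> (\<forall>k. Ck_on k f S)"

text \<open>The manifold is the whole (Hausdorff, second countable) type \<open>'m\<close>, with the smooth structure
  given by an atlas. A chart is a pair of its domain and its coordinate map.\<close>

type_synonym ('m, 'e) chart = "'m set \<times> ('m \<Rightarrow> 'e)"

definition smooth_atlas ::
    "('m::{t2_space,second_countable_topology}, 'e::euclidean_space) chart set \<Rightarrow> bool" where
  "smooth_atlas A \<longleftrightarrow>
     (\<forall>(U, \<phi>)\<in>A. open U \<and> open (\<phi> ` U) \<and> homeomorphism U (\<phi> ` U) \<phi> (inv_into U \<phi>)) \<and>
     (\<Union>(U, \<phi>)\<in>A. U) = UNIV \<and>
     (\<forall>(U, \<phi>)\<in>A. \<forall>(V, \<psi>)\<in>A. smooth_on (\<phi> ` (U \<inter> V)) (\<psi> \<circ> inv_into U \<phi>))"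

definition smooth_map ::
    "('m, 'e::euclidean_space) chart set \<Rightarrow> ('m \<Rightarrow> 'b::real_normed_vector) \<Rightarrow> bool" where
  "smooth_map A f \<longleftrightarrow> (\<forall>(U, \<phi>)\<in>A. smooth_on (\<phi> ` U) (f \<circ> inv_into U \<phi>))"

text \<open>A tangent vector at \<open>p\<close> is a class of pairs of a chart around \<open>p\<close> and a coordinate vector,
  modulo the derivatives of the chart transitions. Each class has exactly one representative in the
  chart \<open>chart_at A p\<close>; so the tangent space at \<open>p\<close> is realised as the coordinate space \<open>'e\<close>
  of that chart. The choice of charts is arbitrary and in no way continuous in \<open>p\<close>; hence
  smoothness of a vector field is not smoothness of it as a map into \<open>'e\<close>, but smoothness of its
  components in all charts of the atlas.\<close>

definition chart_at :: "('m, 'e) chart set \<Rightarrow> 'm \<Rightarrow> ('m, 'e) chart" where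
  "chart_at A p = (SOME c. c \<in> A \<and> p \<in> fst c)"

text \<open>The differential of \<open>f\<close> at \<open>p\<close>, applied to the tangent vector \<open>v\<close>.\<close>

definition diff_at ::
    "('m, 'e::euclidean_space) chart set \<Rightarrow> ('m \<Rightarrow> 'b::real_normed_vector) \<Rightarrow> 'm \<Rightarrow> 'e \<Rightarrow> 'b" where
  "diff_at A f p v =
     (case chart_at A p of (U, \<phi>) \<Rightarrow> frechet_derivative (f \<circ> inv_into U \<phi>) (at (\<phi> p)) v)"

definition vf :: "('m, 'e::euclidean_space) chart set \<Rightarrow> ('m \<Rightarrow> 'e) set" where
  "vf A = {X. \<forall>(U, \<phi>)\<in>A. smooth_on (\<phi> ` U) ((\<lambda>p. diff_at A \<phi> p (X p)) \<circ> inv_into U \<phi>)}"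

definition vf_apply ::
    "('m, 'e::euclidean_space) chart set \<Rightarrow> ('m \<Rightarrow> 'e) \<Rightarrow> ('m \<Rightarrow> real) \<Rightarrow> 'm \<Rightarrow> real" where
  "vf_apply A X f = (\<lambda>p. diff_at A f p (X p))"

text \<open>In local coordinates, \<open>[X, Y]\<^sup>i = X(Y\<^sup>i) - Y(X\<^sup>i)\<close>; at \<open>p\<close> the coordinates are those
  of \<open>chart_at A p\<close>.\<close>

definition lie_bracket ::
    "('m, 'e::euclidean_space) chart set \<Rightarrow> ('m \<Rightarrow> 'e) \<Rightarrow> ('m \<Rightarrow> 'e) \<Rightarrow> 'm \<Rightarrow> 'e" where
  "lie_bracket A X Y = (\<lambda>p. let \<phi> = snd (chart_at A p) in
     diff_at A (\<lambda>q. diff_at A \<phi> q (Y q)) p (X p) - diff_at A (\<lambda>q. diff_at A \<phi> q (X q)) p (Y p))"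

text \<open>Some vector field with value \<open>u\<close> at \<open>p\<close>; used to evaluate tensors given as
  \<open>C\<^sup>\<infinity>\<close>-multilinear maps of vector fields on tangent vectors.\<close>

definition extend_vf :: "('m, 'e::euclidean_space) chart set \<Rightarrow> 'm \<Rightarrow> 'e \<Rightarrow> 'm \<Rightarrow> 'e" where
  "extend_vf A p u = (SOME X. X \<in> vf A \<and> X p = u)"


section \<open>Riemannian almost product manifolds\<close>

definition tensor11 ::
    "('m, 'e::euclidean_space) chart set \<Rightarrow> ('m \<Rightarrow> 'e \<Rightarrow> 'e) \<Rightarrow> bool" where
  "tensor11 A P \<longleftrightarrow> (\<forall>p. linear (P p)) \<and> (\<forall>X\<in>vf A. (\<lambda>p. P p (X p)) \<in> vf A)"

definition riemannian_metric ::
    "('m, 'e::euclidean_space) chart set \<Rightarrow> ('m \<Rightarrow> 'e \<Rightarrow> 'e \<Rightarrow> real) \<Rightarrow> bool" where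
  "riemannian_metric A g \<longleftrightarrow>
     (\<forall>p. bilinear (g p) \<and> (\<forall>u v. g p u v = g p v u) \<and> (\<forall>u. u \<noteq> 0 \<longrightarrow> g p u u > 0)) \<and>
     (\<forall>X\<in>vf A. \<forall>Y\<in>vf A. smooth_map A (\<lambda>p. g p (X p) (Y p)))"

definition riemannian_almost_product ::
    "('m::{t2_space,second_countable_topology}, 'e::euclidean_space) chart set \<Rightarrow>
     ('m \<Rightarrow> 'e \<Rightarrow> 'e) \<Rightarrow> ('m \<Rightarrow> 'e \<Rightarrow> 'e \<Rightarrow> real) \<Rightarrow> bool" where
  "riemannian_almost_product A P g \<longleftrightarrow>
     smooth_atlas A \<and> tensor11 A P \<and> riemannian_metric A g \<and>
     (\<forall>p u. P p (P p u) = u) \<and> (\<forall>p u v. g p (P p u) (P p v) = g p u v)"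

abbreviation app :: "('m \<Rightarrow> 'e \<Rightarrow> 'e) \<Rightarrow> ('m \<Rightarrow> 'e) \<Rightarrow> 'm \<Rightarrow> 'e" where
  "app P X \<equiv> (\<lambda>p. P p (X p))"

abbreviation ip :: "('m \<Rightarrow> 'e \<Rightarrow> 'e \<Rightarrow> real) \<Rightarrow> ('m \<Rightarrow> 'e) \<Rightarrow> ('m \<Rightarrow> 'e) \<Rightarrow> 'm \<Rightarrow> real" where
  "ip g X Y \<equiv> (\<lambda>p. g p (X p) (Y p))"

text \<open>Connections are covariant derivatives \<open>D X Y\<close>, relevant on \<open>vf A\<close> only.\<close>

type_synonym ('m, 'e) connection = "('m \<Rightarrow> 'e) \<Rightarrow> ('m \<Rightarrow> 'e) \<Rightarrow> 'm \<Rightarrow> 'e"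

definition linear_connection ::
    "('m, 'e::euclidean_space) chart set \<Rightarrow> ('m, 'e) connection \<Rightarrow> bool" where
  "linear_connection A D \<longleftrightarrow>
     (\<forall>X\<in>vf A. \<forall>Y\<in>vf A. D X Y \<in> vf A) \<and>
     (\<forall>X\<in>vf A. \<forall>Y\<in>vf A. \<forall>Z\<in>vf A.
        D (\<lambda>p. X p + Y p) Z = (\<lambda>p. D X Z p + D Y Z p) \<and>
        D X (\<lambda>p. Y p + Z p) = (\<lambda>p. D X Y p + D X Z p)) \<and>
     (\<forall>f X Y. smooth_map A f \<longrightarrow> X \<in> vf A \<longrightarrow> Y \<in> vf A \<longrightarrow>
        D (\<lambda>p. f p *\<^sub>R X p) Y = (\<lambda>p. f p *\<^sub>R D X Y p) \<and>
        D X (\<lambda>p. f p *\<^sub>R Y p) = (\<lambda>p. vf_apply A X f p *\<^sub>R Y p + f p *\<^sub>R D X Y p))"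

definition levi_civita ::
    "('m, 'e::euclidean_space) chart set \<Rightarrow> ('m \<Rightarrow> 'e \<Rightarrow> 'e \<Rightarrow> real) \<Rightarrow> ('m, 'e) connection \<Rightarrow> bool" where
  "levi_civita A g D \<longleftrightarrow>
     linear_connection A D \<and>
     (\<forall>X\<in>vf A. \<forall>Y\<in>vf A. (\<lambda>p. D X Y p - D Y X p) = lie_bracket A X Y) \<and>
     (\<forall>X\<in>vf A. \<forall>Y\<in>vf A. \<forall>Z\<in>vf A.
        vf_apply A X (ip g Y Z) = (\<lambda>p. ip g (D X Y) Z p + ip g Y (D X Z) p))"

text \<open>\<open>F(x, y, z) = g((\<nabla>\<^sub>x P) y, z)\<close>, where \<open>(\<nabla>\<^sub>x P) y = \<nabla>\<^sub>x (P y) - P (\<nabla>\<^sub>x y)\<close>.\<close>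

definition fundamental_F ::
    "('m \<Rightarrow> 'e::euclidean_space \<Rightarrow> 'e) \<Rightarrow> ('m \<Rightarrow> 'e \<Rightarrow> 'e \<Rightarrow> real) \<Rightarrow> ('m, 'e) connection \<Rightarrow>
     ('m \<Rightarrow> 'e) \<Rightarrow> ('m \<Rightarrow> 'e) \<Rightarrow> ('m \<Rightarrow> 'e) \<Rightarrow> 'm \<Rightarrow> real" where
  "fundamental_F P g D x y z = ip g (\<lambda>p. D x (app P y) p - app P (D x y) p) z"

definition gram :: "('m \<Rightarrow> real^'d \<Rightarrow> real^'d \<Rightarrow> real) \<Rightarrow> 'm \<Rightarrow> real^'d^'d" where
  "gram g p = (\<chi> i j. g p (axis i 1) (axis j 1))"

text \<open>The trace defining \<open>\<theta>\<close> does not depend on the basis; at \<open>p\<close> it is taken over the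
  coordinate basis of the tangent space given by \<open>chart_at A p\<close>.\<close>

definition theta ::
    "('m, real^'d) chart set \<Rightarrow> ('m \<Rightarrow> real^'d \<Rightarrow> real^'d) \<Rightarrow> ('m \<Rightarrow> real^'d \<Rightarrow> real^'d \<Rightarrow> real) \<Rightarrow>
     ('m, real^'d) connection \<Rightarrow> ('m \<Rightarrow> real^'d) \<Rightarrow> 'm \<Rightarrow> real" where
  "theta A P g D x = (\<lambda>p. \<Sum>i\<in>UNIV. \<Sum>j\<in>UNIV. matrix_inv (gram g p) $ i $ j *
     fundamental_F P g D (extend_vf A p (axis i 1)) (extend_vf A p (axis j 1)) x p)"

text \<open>\<open>(\<nabla>\<^sub>x \<omega>) y = x(\<omega>(y)) - \<omega>(\<nabla>\<^sub>x y)\<close>.\<close>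

definition nabla_form ::
    "('m, 'e::euclidean_space) chart set \<Rightarrow> ('m, 'e) connection \<Rightarrow> (('m \<Rightarrow> 'e) \<Rightarrow> 'm \<Rightarrow> real) \<Rightarrow>
     ('m \<Rightarrow> 'e) \<Rightarrow> ('m \<Rightarrow> 'e) \<Rightarrow> 'm \<Rightarrow> real" where
  "nabla_form A D \<omega> x y = (\<lambda>p. vf_apply A x (\<omega> y) p - \<omega> (D x y) p)"

text \<open>The class \<open>\<W>\<^sub>1\<close>; \<open>D\<close> is the Levi-Civita connection of \<open>g\<close>.\<close>

definition W1_manifold ::
    "nat \<Rightarrow> ('m::{t2_space,second_countable_topology}, real^'d) chart set \<Rightarrow>
     ('m \<Rightarrow> real^'d \<Rightarrow> real^'d) \<Rightarrow> ('m \<Rightarrow> real^'d \<Rightarrow> real^'d \<Rightarrow> real) \<Rightarrow>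
     ('m, real^'d) connection \<Rightarrow> bool" where
  "W1_manifold n A P g D \<longleftrightarrow>
     riemannian_almost_product A P g \<and> levi_civita A g D \<and>
     CARD('d) = 2 * n \<and> (\<forall>p. trace (matrix (P p)) = 0) \<and>
     (let \<theta> = theta A P g D in
      \<forall>x\<in>vf A. \<forall>y\<in>vf A. \<forall>z\<in>vf A. \<forall>p.
        fundamental_F P g D x y z p =
          1 / (2 * real n) *
          (ip g x y p * \<theta> z p - ip g x (app P y) p * \<theta> (app P z) p
           + ip g x z p * \<theta> y p - ip g x (app P z) p * \<theta> (app P y) p))"


section \<open>The natural connections and their curvature\<close>

definition natural_connection ::
    "nat \<Rightarrow> ('m, real^'d) chart set \<Rightarrow> ('m \<Rightarrow> real^'d \<Rightarrow> real^'d) \<Rightarrow>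
     ('m \<Rightarrow> real^'d \<Rightarrow> real^'d \<Rightarrow> real) \<Rightarrow> ('m, real^'d) connection \<Rightarrow> ('m \<Rightarrow> real^'d) \<Rightarrow>
     real \<Rightarrow> real \<Rightarrow> ('m, real^'d) connection" where
  "natural_connection n A P g D \<Omega> lam mu x y =
     (let \<theta> = theta A P g D; mu' = mu + 1 / (2 * real n) in
      (\<lambda>p. D x y p
         + ip g x (app P y) p *\<^sub>R (lam *\<^sub>R app P \<Omega> p + mu *\<^sub>R \<Omega> p)
         - (lam * \<theta> (app P y) p + mu * \<theta> y p) *\<^sub>R app P x p
         + ip g x y p *\<^sub>R (lam *\<^sub>R \<Omega> p + mu' *\<^sub>R app P \<Omega> p)
         - (lam * \<theta> y p + mu' * \<theta> (app P y) p) *\<^sub>R x p))"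

definition curvature ::
    "('m, 'e::euclidean_space) chart set \<Rightarrow> ('m, 'e) connection \<Rightarrow>
     ('m \<Rightarrow> 'e) \<Rightarrow> ('m \<Rightarrow> 'e) \<Rightarrow> ('m \<Rightarrow> 'e) \<Rightarrow> 'm \<Rightarrow> 'e" where
  "curvature A D x y z = (\<lambda>p. D x (D y z) p - D y (D x z) p - D (lie_bracket A x y) z p)"

definition curvature4 ::
    "('m, 'e::euclidean_space) chart set \<Rightarrow> ('m \<Rightarrow> 'e \<Rightarrow> 'e \<Rightarrow> real) \<Rightarrow> ('m, 'e) connection \<Rightarrow>
     ('m \<Rightarrow> 'e) \<Rightarrow> ('m \<Rightarrow> 'e) \<Rightarrow> ('m \<Rightarrow> 'e) \<Rightarrow> ('m \<Rightarrow> 'e) \<Rightarrow> 'm \<Rightarrow> real" where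
  "curvature4 A g D x y z w = ip g (curvature A D x y z) w"

type_synonym ('m, 'e) form4 =
  "('m \<Rightarrow> 'e) \<Rightarrow> ('m \<Rightarrow> 'e) \<Rightarrow> ('m \<Rightarrow> 'e) \<Rightarrow> ('m \<Rightarrow> 'e) \<Rightarrow> 'm \<Rightarrow> real"

definition fun_linear_form ::
    "('m, 'e::euclidean_space) chart set \<Rightarrow> (('m \<Rightarrow> 'e) \<Rightarrow> 'm \<Rightarrow> real) \<Rightarrow> bool" where
  "fun_linear_form A \<omega> \<longleftrightarrow>
     (\<forall>X\<in>vf A. smooth_map A (\<omega> X)) \<and>
     (\<forall>X\<in>vf A. \<forall>Y\<in>vf A. \<omega> (\<lambda>p. X p + Y p) = (\<lambda>p. \<omega> X p + \<omega> Y p)) \<and>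
     (\<forall>f. smooth_map A f \<longrightarrow> (\<forall>X\<in>vf A. \<omega> (\<lambda>p. f p *\<^sub>R X p) = (\<lambda>p. f p * \<omega> X p)))"

text \<open>\<open>(0,4)\<close>-tensors as \<open>C\<^sup>\<infinity>\<close>-multilinear maps on vector fields.\<close>

definition tensor04 :: "('m, 'e::euclidean_space) chart set \<Rightarrow> ('m, 'e) form4 \<Rightarrow> bool" where
  "tensor04 A L \<longleftrightarrow> (\<forall>x\<in>vf A. \<forall>y\<in>vf A. \<forall>z\<in>vf A.
     fun_linear_form A (\<lambda>v. L v x y z) \<and> fun_linear_form A (\<lambda>v. L x v y z) \<and>
     fun_linear_form A (\<lambda>v. L x y v z) \<and> fun_linear_form A (\<lambda>v. L x y z v))"

definition riemannian_P_tensor ::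
    "('m, 'e::euclidean_space) chart set \<Rightarrow> ('m \<Rightarrow> 'e \<Rightarrow> 'e) \<Rightarrow> ('m, 'e) form4 \<Rightarrow> bool" where
  "riemannian_P_tensor A P L \<longleftrightarrow>
     tensor04 A L \<and>
     (\<forall>x\<in>vf A. \<forall>y\<in>vf A. \<forall>z\<in>vf A. \<forall>w\<in>vf A. \<forall>p.
        L x y z w p = - L y x z w p \<and>
        L x y z w p = - L x y w z p \<and>
        L x y z w p + L y z x w p + L z x y w p = 0 \<and>
        L x y (app P z) (app P w) p = L x y z w p)"

end

theory Submission
  imports Defs
begin

text \<open>Write \<open>\<alpha> = \<lambda> \<theta>\<circ>P + \<mu> \<theta>\<close> and \<open>\<beta> = \<lambda> \<theta> + (\<mu> + 1/(2n)) \<theta>\<circ>P\<close>. The natural connection \<open>\<nabla>'\<close> is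
\<open>\<nabla>\<close> plus a tensor; the formula for \<open>\<nabla>P\<close> on a \<open>\<W>\<^sub>1\<close>-manifold makes \<open>P\<close> parallel for \<open>\<nabla>'\<close>, and the added
tensor is skew with respect to \<open>g\<close>, so \<open>g\<close> is parallel too. Hence \<open>R'\<close> is always a tensor, skew in both
pairs of arguments and compatible with \<open>P\<close>. Only the first Bianchi identity is in question.

The torsion of \<open>\<nabla>'\<close> is \<open>T(x,y) = \<alpha>(x) Py - \<alpha>(y) Px + \<beta>(x) y - \<beta>(y) x\<close>. Inserting it in the Bianchi
identity for connections with torsion (\<open>cyclic_sum_curvature\<close>), all terms quadratic in \<open>\<alpha>, \<beta>\<close> cancel and
what remains is (\<open>natural_cyclic_sum\<close>)

  \<open>R'(x,y)z + R'(y,z)x + R'(z,x)y = cyclic sum of d\<beta>(x,y) z + d\<alpha>(x,y) Pz\<close>.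

Since \<open>F\<close> is such that \<open>(x,y) \<mapsto> F(x,\<Omega>,y)\<close> is symmetric, \<open>d(\<theta>\<circ>P)(y,z)\<close> equals
\<open>(\<nabla>\<^sub>y \<theta>)Pz - (\<nabla>\<^sub>z \<theta>)Py\<close>, so the two conditions of the theorem say exactly \<open>d\<beta> = 0\<close> and \<open>d\<alpha> = 0\<close>. That they
imply the Bianchi identity is then clear.

For the converse, decompose vectors along the eigenbundles \<open>V\<^sub>+\<close>, \<open>V\<^sub>-\<close> of \<open>P\<close>, both of rank \<open>n \<ge> 2\<close>.
A cyclic sum over \<open>x, z, y\<close> with \<open>x, y\<close> orthogonal in one eigenbundle and \<open>z\<close> in the other gives
\<open>(d\<beta> \<plusminus> d\<alpha>)(z,x) = 0\<close>, so \<open>d\<alpha>\<close> and \<open>d\<beta>\<close> vanish on mixed pairs (\<open>mixed_sign_Bianchi\<close>). On pairs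
within one eigenbundle linear independence would need a third independent vector there, which for \<open>n = 2\<close> does not
exist. Instead, \<open>\<theta>\<close> and \<open>\<theta>\<circ>P\<close> are closed on such pairs on every \<open>\<W>\<^sub>1\<close>-manifold
(\<open>same_sign_closed\<close>): for \<open>x, y \<in> V\<^sub>+\<close> and \<open>z \<in> V\<^sub>-\<close> the \<open>z\<close>-component of the
cyclic sum of \<open>R'\<close> vanishes because \<open>R'\<close> is skew and preserves the eigenbundles, while the right-hand side gives
\<open>(d\<beta> - d\<alpha>)(x,y)\<close>; taking two different pairs \<open>(\<lambda>,\<mu>)\<close> yields both closedness statements.

These arguments evaluate tensors at a point on vector fields with prescribed values there, so every tangent vector has
to be extended to a global vector field (\<open>vf_extension\<close>); this, the commutator formula for the Lie bracket and its
Jacobi identity are derived from the calculus of smooth maps in charts.\<close>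

section \<open>Calculus of continuously differentiable maps\<close>

lemma Ck_on_cong:
  assumes "open S" "Ck_on k f S" "\<And>x. x \<in> S \<Longrightarrow> f x = g x"
  shows "Ck_on k g S"
  using assms(2,3)
proof (induction k arbitrary: f g)
  case 0
  then show ?case by (metis Ck_on.simps(1) continuous_on_cong)
next
  case (Suc k)
  have d: "f differentiable (at x)" if "x \<in> S" for x
    using Suc.prems(1) \<open>open S\<close> that by (simp add: differentiable_on_eq_differentiable_at)
  have "g differentiable (at x)" if "x \<in> S" for x
    using d[OF that] Suc.prems(2) \<open>open S\<close> that unfolding differentiable_def
    by (metis has_derivative_transform_within_open)
  then have "g differentiable_on S"
    by (simp add: differentiable_at_imp_differentiable_on)
  moreover have "frechet_derivative f (at x) = frechet_derivative g (at x)" if "x \<in> S" for x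
    by (rule frechet_derivative_transform_within_open[OF d[OF that] \<open>open S\<close> that Suc.prems(2)])
  ultimately show ?case
    using Suc.IH[of "\<lambda>x. frechet_derivative f (at x) v" "\<lambda>x. frechet_derivative g (at x) v" for v]
      Suc.prems(1) by auto
qed

lemma Ck_on_subset: "Ck_on k f S \<Longrightarrow> T \<subseteq> S \<Longrightarrow> Ck_on k f T"
proof (induction k arbitrary: f)
  case (Suc k)
  then show ?case using differentiable_on_subset[of f S T] by simp
qed (simp add: continuous_on_subset)

lemma Ck_on_Suc_lower: "Ck_on (Suc k) f S \<Longrightarrow> Ck_on k f S"
proof (induction k arbitrary: f)
  case 0
  then show ?case by (simp add: differentiable_imp_continuous_on)
next
  case (Suc k)
  then have "f differentiable_on S" "Ck_on k (\<lambda>x. frechet_derivative f (at x) v) S" for v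
    by simp_all
  then show ?case by simp
qed

lemma Ck_on_open_cover:
  assumes "\<And>T. T \<in> \<C> \<Longrightarrow> open T \<and> Ck_on k f T"
  shows "Ck_on k f (\<Union>\<C>)"
  using assms
proof (induction k arbitrary: f)
  case 0
  then show ?case by (simp add: continuous_on_open_Union)
next
  case (Suc k)
  then have "f differentiable (at x)" if "x \<in> \<Union>\<C>" for x
    using that by (force simp: differentiable_on_eq_differentiable_at)
  then have "f differentiable_on \<Union>\<C>"
    by (rule differentiable_at_imp_differentiable_on)
  moreover have "Ck_on k (\<lambda>x. frechet_derivative f (at x) v) (\<Union>\<C>)" for v
    using Suc.prems by (intro Suc.IH) simp
  ultimately show ?case by simp
qed

lemma Ck_on_const: "Ck_on k (\<lambda>x. c) S"
  by (induction k arbitrary: c) auto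

text \<open>The definition of \<open>Ck_on\<close> uses \<open>frechet_derivative\<close>; with this rule any family of derivatives that is
valid on the open set may be supplied instead.\<close>

lemma Ck_on_SucI:
  assumes "open S" "\<And>x. x \<in> S \<Longrightarrow> (f has_derivative f' x) (at x)" "\<And>v. Ck_on k (\<lambda>x. f' x v) S"
  shows "Ck_on (Suc k) f S"
proof -
  have "f differentiable_on S"
    using assms(2) by (intro differentiable_at_imp_differentiable_on) (auto simp: differentiable_def)
  moreover have "Ck_on k (\<lambda>x. frechet_derivative f (at x) v) S" for v
  proof (rule Ck_on_cong[OF assms(1) assms(3)[of v]])
    show "f' x v = frechet_derivative f (at x) v" if "x \<in> S" for x
      using frechet_derivative_at[OF assms(2)[OF that]] by simp
  qed
  ultimately show ?thesis by simp
qed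

lemma Ck_on_SucD:
  assumes "Ck_on (Suc k) f S" "open S"
  shows "x \<in> S \<Longrightarrow> (f has_derivative frechet_derivative f (at x)) (at x)"
    and "Ck_on k (\<lambda>x. frechet_derivative f (at x) v) S"
  using assms by (auto simp: differentiable_on_eq_differentiable_at frechet_derivative_works)

lemma Ck_on_bounded_linear_compose:
  assumes "bounded_linear h" "open S" "Ck_on k f S"
  shows "Ck_on k (\<lambda>x. h (f x)) S"
  using assms(3)
proof (induction k arbitrary: f)
  case 0
  then show ?case using bounded_linear.continuous_on[OF assms(1), of S f] by simp
next
  case (Suc k)
  note D = Ck_on_SucD[OF Suc.prems \<open>open S\<close>]
  have "((\<lambda>x. h (f x)) has_derivative (\<lambda>v. h (frechet_derivative f (at x) v))) (at x)"
    if "x \<in> S" for x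
    by (rule bounded_linear.has_derivative[OF assms(1) D(1)[OF that]])
  then show ?case
  proof (rule Ck_on_SucI[OF \<open>open S\<close>])
    show "Ck_on k (\<lambda>x. h (frechet_derivative f (at x) v)) S" for v
      by (rule Suc.IH[OF D(2)])
  qed
qed

lemma Ck_on_add:
  assumes "open S" "Ck_on k f S" "Ck_on k g S"
  shows "Ck_on k (\<lambda>x. f x + g x) S"
  using assms(2,3)
proof (induction k arbitrary: f g)
  case 0
  then show ?case using continuous_on_add[of S f g] by simp
next
  case (Suc k)
  note D = Ck_on_SucD[OF Suc.prems(1) \<open>open S\<close>] Ck_on_SucD[OF Suc.prems(2) \<open>open S\<close>]
  have "((\<lambda>x. f x + g x) has_derivative
      (\<lambda>v. frechet_derivative f (at x) v + frechet_derivative g (at x) v)) (at x)" if "x \<in> S" for x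
    by (rule has_derivative_add[OF D(1)[OF that] D(3)[OF that]])
  then show ?case
  proof (rule Ck_on_SucI[OF \<open>open S\<close>])
    show "Ck_on k (\<lambda>x. frechet_derivative f (at x) v + frechet_derivative g (at x) v) S" for v
      by (rule Suc.IH[OF D(2) D(4)])
  qed
qed

text \<open>By the product rule the derivative is a sum of two terms of the same form, each with one factor differentiated; the
undifferentiated factor is used with its order lowered by one.\<close>

lemma Ck_on_bilinear:
  assumes "bounded_bilinear h" "open S" "Ck_on k f S" "Ck_on k g S"
  shows "Ck_on k (\<lambda>x. h (f x) (g x)) S"
  using assms(3,4)
proof (induction k arbitrary: f g)
  case 0
  then have "continuous_on S f" "continuous_on S g" by simp_all
  then show ?case
    using bounded_bilinear.continuous_on[OF assms(1), of S f g] by simp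
next
  case (Suc k)
  note D = Ck_on_SucD[OF Suc.prems(1) \<open>open S\<close>] Ck_on_SucD[OF Suc.prems(2) \<open>open S\<close>]
  note lower = Suc.prems[THEN Ck_on_Suc_lower]
  have "((\<lambda>x. h (f x) (g x)) has_derivative (\<lambda>v. h (f x) (frechet_derivative g (at x) v)
      + h (frechet_derivative f (at x) v) (g x))) (at x)" if "x \<in> S" for x
    by (rule bounded_bilinear.FDERIV[OF assms(1) D(1)[OF that] D(3)[OF that]])
  then show ?case
  proof (rule Ck_on_SucI[OF \<open>open S\<close>])
    show "Ck_on k (\<lambda>x. h (f x) (frechet_derivative g (at x) v)
        + h (frechet_derivative f (at x) v) (g x)) S" for v
      by (rule Ck_on_add[OF \<open>open S\<close> Suc.IH[OF lower(1) D(4)] Suc.IH[OF D(2) lower(2)]])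
  qed
qed

lemma Ck_on_sum:
  assumes "open S" "\<And>i. i \<in> I \<Longrightarrow> Ck_on k (f i) S"
  shows "Ck_on k (\<lambda>x. \<Sum>i\<in>I. f i x) S"
  using assms(2)
  by (induction I rule: infinite_finite_induct) (auto intro!: Ck_on_const Ck_on_add \<open>open S\<close>)

lemma linear_Basis_expansion:
  fixes v :: "'a::euclidean_space"
  assumes "linear h"
  shows "h v = (\<Sum>b\<in>Basis. (v \<bullet> b) *\<^sub>R h b)"
proof -
  have "h v = h (\<Sum>b\<in>Basis. (v \<bullet> b) *\<^sub>R b)"
    by (simp only: euclidean_representation)
  also have "\<dots> = (\<Sum>b\<in>Basis. (v \<bullet> b) *\<^sub>R h b)"
    by (simp add: linear_sum[OF assms] linear_scale[OF assms])
  finally show ?thesis .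
qed

text \<open>Expanding the argument in the basis reduces a derivative in a variable direction to derivatives in fixed directions, which are the
ones that \<open>Ck_on\<close> speaks of. The map \<open>g\<close> makes the lemma usable inside the chain rule as well.\<close>

lemma Ck_on_derivative_apply:
  fixes f :: "'a::euclidean_space \<Rightarrow> 'b::real_normed_vector"
    and g :: "'c::euclidean_space \<Rightarrow> 'a" and V :: "'c \<Rightarrow> 'a"
  assumes "open S" "\<And>x. x \<in> S \<Longrightarrow> f differentiable (at (g x))"
    and "\<And>b. Ck_on k (\<lambda>x. frechet_derivative f (at (g x)) b) S" "Ck_on k V S"
  shows "Ck_on k (\<lambda>x. frechet_derivative f (at (g x)) (V x)) S"
proof (rule Ck_on_cong[OF \<open>open S\<close>])
  show "Ck_on k (\<lambda>x. \<Sum>b\<in>Basis. (V x \<bullet> b) *\<^sub>R frechet_derivative f (at (g x)) b) S"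
  proof (rule Ck_on_sum[OF assms(1)])
    fix b :: 'a
    have "Ck_on k (\<lambda>x. V x \<bullet> b) S"
      using Ck_on_bounded_linear_compose[OF bounded_linear_inner_left assms(1,4)] .
    then show "Ck_on k (\<lambda>x. (V x \<bullet> b) *\<^sub>R frechet_derivative f (at (g x)) b) S"
      using Ck_on_bilinear[OF bounded_bilinear_scaleR assms(1) _ assms(3)] by blast
  qed
  show "(\<Sum>b\<in>Basis. (V x \<bullet> b) *\<^sub>R frechet_derivative f (at (g x)) b)
      = frechet_derivative f (at (g x)) (V x)" if "x \<in> S" for x
    by (rule linear_Basis_expansion[OF linear_frechet_derivative[OF assms(2)[OF that]], symmetric])
qed

lemma Ck_on_compose:
  fixes f :: "'a::euclidean_space \<Rightarrow> 'b::real_normed_vector" and g :: "'c::euclidean_space \<Rightarrow> 'a"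
  assumes "open S" "open T" "g ` S \<subseteq> T" "Ck_on k f T" "Ck_on k g S"
  shows "Ck_on k (\<lambda>x. f (g x)) S"
  using assms(4,5)
proof (induction k arbitrary: f)
  case 0
  then show ?case using continuous_on_compose2 assms(3) by (metis Ck_on.simps(1))
next
  case (Suc k)
  have df: "f differentiable (at (g x))" if "x \<in> S" for x
    using Suc.prems that assms(2,3) by (auto simp: differentiable_on_eq_differentiable_at)
  note D = Ck_on_SucD[OF Suc.prems(1) \<open>open T\<close>] Ck_on_SucD[OF Suc.prems(2) \<open>open S\<close>]
  have "((\<lambda>x. f (g x)) has_derivative
      (\<lambda>v. frechet_derivative f (at (g x)) (frechet_derivative g (at x) v))) (at x)"
    if "x \<in> S" for x
    using D(1)[of "g x"] D(3)[OF that] diff_chain_at[of g _ x f] that assms(3)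
    by (auto simp: o_def)
  then show ?case
  proof (rule Ck_on_SucI[OF \<open>open S\<close>])
    show "Ck_on k (\<lambda>x. frechet_derivative f (at (g x)) (frechet_derivative g (at x) v)) S" for v
      by (rule Ck_on_derivative_apply[OF \<open>open S\<close> df Suc.IH[OF D(2) Ck_on_Suc_lower[OF Suc.prems(2)]] D(4)])
  qed
qed

lemma smooth_on_cong:
  "open S \<Longrightarrow> smooth_on S f \<Longrightarrow> (\<And>x. x \<in> S \<Longrightarrow> f x = g x) \<Longrightarrow> smooth_on S g"
  unfolding smooth_on_def using Ck_on_cong by blast

lemma smooth_on_subset: "smooth_on S f \<Longrightarrow> T \<subseteq> S \<Longrightarrow> smooth_on T f"
  unfolding smooth_on_def using Ck_on_subset by blast

lemma smooth_on_open_cover: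
  "(\<And>T. T \<in> \<C> \<Longrightarrow> open T \<and> smooth_on T f) \<Longrightarrow> smooth_on (\<Union>\<C>) f"
  unfolding smooth_on_def using Ck_on_open_cover by blast

lemma smooth_on_const: "smooth_on S (\<lambda>x. c)"
  unfolding smooth_on_def using Ck_on_const by blast

lemma smooth_on_add:
  "open S \<Longrightarrow> smooth_on S f \<Longrightarrow> smooth_on S g \<Longrightarrow> smooth_on S (\<lambda>x. f x + g x)"
  unfolding smooth_on_def using Ck_on_add by blast

lemma smooth_on_bilinear:
  "bounded_bilinear h \<Longrightarrow> open S \<Longrightarrow> smooth_on S f \<Longrightarrow> smooth_on S g \<Longrightarrow>
    smooth_on S (\<lambda>x. h (f x) (g x))"
  unfolding smooth_on_def using Ck_on_bilinear by blast

lemma smooth_on_compose: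
  fixes f :: "'a::euclidean_space \<Rightarrow> 'b::real_normed_vector" and g :: "'c::euclidean_space \<Rightarrow> 'a"
  shows "open S \<Longrightarrow> open T \<Longrightarrow> g ` S \<subseteq> T \<Longrightarrow> smooth_on T f \<Longrightarrow> smooth_on S g \<Longrightarrow>
    smooth_on S (\<lambda>x. f (g x))"
  unfolding smooth_on_def using Ck_on_compose by blast

lemma smooth_on_imp_differentiable:
  "smooth_on S f \<Longrightarrow> open S \<Longrightarrow> x \<in> S \<Longrightarrow> f differentiable (at x)"
  unfolding smooth_on_def
  by (drule spec[of _ "Suc 0"]) (simp add: differentiable_on_eq_differentiable_at)

lemma smooth_on_derivative: "smooth_on S f \<Longrightarrow> smooth_on S (\<lambda>x. frechet_derivative f (at x) v)"
  unfolding smooth_on_def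
proof
  fix k assume "\<forall>k. Ck_on k f S"
  then have "Ck_on (Suc k) f S" by blast
  then show "Ck_on k (\<lambda>x. frechet_derivative f (at x) v) S" by simp
qed

lemma smooth_on_derivative_apply:
  fixes f :: "'a::euclidean_space \<Rightarrow> 'b::real_normed_vector"
  assumes "open S" "smooth_on S f" "smooth_on S V"
  shows "smooth_on S (\<lambda>x. frechet_derivative f (at x) (V x))"
  unfolding smooth_on_def
proof
  show "Ck_on k (\<lambda>x. frechet_derivative f (at x) (V x)) S" for k
    using Ck_on_derivative_apply[OF assms(1), of f "\<lambda>x. x" k V] assms(3)
      smooth_on_derivative[OF assms(2)] smooth_on_imp_differentiable[OF assms(2,1)]
    unfolding smooth_on_def by blast
qed

lemma smooth_on_ident: "smooth_on S (\<lambda>x. x)"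
proof -
  have "Ck_on k (\<lambda>x. x) S" for k
    by (cases k) (auto simp: Ck_on_const)
  then show ?thesis by (simp add: smooth_on_def)
qed

section \<open>Symmetry of second derivatives\<close>

text \<open>The mean value theorem applied first in direction \<open>u\<close> and then in direction \<open>v\<close>. The left-hand side is
symmetric in \<open>u\<close> and \<open>v\<close>, which is what makes the second derivative symmetric.\<close>

lemma mixed_difference_mean_value:
  fixes f :: "'a::euclidean_space \<Rightarrow> real"
  assumes "0 < h"
    and df: "\<And>s t. s \<in> {0..h} \<Longrightarrow> t \<in> {0..h} \<Longrightarrow> f differentiable (at (x + s *\<^sub>R u + t *\<^sub>R v))"
    and du: "\<And>s t. s \<in> {0..h} \<Longrightarrow> t \<in> {0..h} \<Longrightarrow>
      (\<lambda>x. frechet_derivative f (at x) u) differentiable (at (x + s *\<^sub>R u + t *\<^sub>R v))"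
  obtains s t where "s \<in> {0..h}" "t \<in> {0..h}"
    "f (x + h *\<^sub>R u + h *\<^sub>R v) - f (x + h *\<^sub>R u) - f (x + h *\<^sub>R v) + f x =
      h * (h * frechet_derivative (\<lambda>x. frechet_derivative f (at x) u) (at (x + s *\<^sub>R u + t *\<^sub>R v)) v)"
proof -
  define Du where "Du = (\<lambda>x. frechet_derivative f (at x) u)"
  have curve: "((\<lambda>s. F (a + s *\<^sub>R w)) has_real_derivative frechet_derivative F (at (a + s *\<^sub>R w)) w) (at s)"
    if F: "F differentiable (at (a + s *\<^sub>R w))" for F :: "'a \<Rightarrow> real" and a w s
  proof -
    have "((\<lambda>s. a + s *\<^sub>R w) has_derivative (\<lambda>r. r *\<^sub>R w)) (at s)"
      by (auto intro!: derivative_eq_intros)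
    from has_derivative_compose[OF this] F
    have "((\<lambda>s. F (a + s *\<^sub>R w)) has_derivative
        (\<lambda>r. frechet_derivative F (at (a + s *\<^sub>R w)) (r *\<^sub>R w))) (at s)"
      by (auto simp: frechet_derivative_works)
    then show ?thesis
      using linear_scale[OF linear_frechet_derivative[OF F]]
      by (simp add: has_field_derivative_def mult.commute[of _ "frechet_derivative F _ w"] o_def)
  qed
  have "((\<lambda>s. f (x + s *\<^sub>R u + h *\<^sub>R v) - f (x + s *\<^sub>R u)) has_real_derivative
      Du (x + s *\<^sub>R u + h *\<^sub>R v) - Du (x + s *\<^sub>R u)) (at s)" if "0 \<le> s" "s \<le> h" for s
    unfolding Du_def
    using curve[of f "x + h *\<^sub>R v" s u] curve[of f x s u] df[of s h] df[of s 0] that \<open>0 < h\<close>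
    by (auto intro!: DERIV_diff simp: algebra_simps)
  from MVT2[OF \<open>0 < h\<close> this] obtain s where s: "0 < s" "s < h"
    "f (x + h *\<^sub>R u + h *\<^sub>R v) - f (x + h *\<^sub>R u) - (f (x + h *\<^sub>R v) - f x) =
      h * (Du (x + s *\<^sub>R u + h *\<^sub>R v) - Du (x + s *\<^sub>R u))"
    by auto
  have "((\<lambda>t. Du (x + s *\<^sub>R u + t *\<^sub>R v)) has_real_derivative
      frechet_derivative Du (at (x + s *\<^sub>R u + t *\<^sub>R v)) v) (at t)" if "0 \<le> t" "t \<le> h" for t
    using curve[of Du "x + s *\<^sub>R u" t v] du[of s t] s that unfolding Du_def by simp
  from MVT2[OF \<open>0 < h\<close> this] obtain t where t: "0 < t" "t < h"
    "Du (x + s *\<^sub>R u + h *\<^sub>R v) - Du (x + s *\<^sub>R u) =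
      h * frechet_derivative Du (at (x + s *\<^sub>R u + t *\<^sub>R v)) v"
    by auto
  show thesis
    using that[of s t] s t unfolding Du_def by simp
qed

text \<open>Both iterated derivatives, taken at suitable points close to \<open>x\<close>, equal the same mixed difference; continuity moves
the points to \<open>x\<close>.\<close>

lemma second_derivative_symmetric_real:
  fixes f :: "'a::euclidean_space \<Rightarrow> real"
  assumes "open S" "smooth_on S f" "x \<in> S"
  shows "frechet_derivative (\<lambda>x. frechet_derivative f (at x) u) (at x) v
       = frechet_derivative (\<lambda>x. frechet_derivative f (at x) v) (at x) u"
    (is "?uv x = ?vu x")
proof -
  have cont: "isCont (\<lambda>x. frechet_derivative (\<lambda>x. frechet_derivative f (at x) a) (at x) b) x" for a b
    using smooth_on_derivative[OF smooth_on_derivative[OF assms(2)], of a b] assms(1,3)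
    by (meson differentiable_imp_continuous_within smooth_on_imp_differentiable)
  have "\<bar>?uv x - ?vu x\<bar> \<le> e" if "e > 0" for e
  proof -
    obtain d1 where d1: "d1 > 0" "\<And>y. dist y x < d1 \<Longrightarrow> \<bar>?uv y - ?uv x\<bar> < e / 2"
      using cont[of u v] \<open>e > 0\<close> unfolding continuous_at_eps_delta
      by (metis dist_real_def half_gt_zero)
    obtain d2 where d2: "d2 > 0" "\<And>y. dist y x < d2 \<Longrightarrow> \<bar>?vu y - ?vu x\<bar> < e / 2"
      using cont[of v u] \<open>e > 0\<close> unfolding continuous_at_eps_delta
      by (metis dist_real_def half_gt_zero)
    obtain d3 where d3: "d3 > 0" "\<And>y. dist y x < d3 \<Longrightarrow> y \<in> S"
      using assms(1,3) by (metis open_dist)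
    define d where "d = min d1 (min d2 d3)"
    have "d > 0" using d1 d2 d3 by (simp add: d_def)
    define h where "h = d / (2 * (norm u + norm v + 1))"
    have "h > 0" using \<open>d > 0\<close> by (simp add: h_def add_nonneg_pos)
    have near: "dist (x + s *\<^sub>R u + t *\<^sub>R v) x < d" if "s \<in> {0..h}" "t \<in> {0..h}" for s t
    proof -
      have "norm (s *\<^sub>R u + t *\<^sub>R v) \<le> h * norm u + h * norm v"
        using that norm_triangle_ineq[of "s *\<^sub>R u" "t *\<^sub>R v"]
        by (smt (verit, best) atLeastAtMost_iff mult_right_mono norm_ge_zero norm_scaleR)
      also have "\<dots> \<le> h * (norm u + norm v + 1)"
        using \<open>h > 0\<close> by (simp add: algebra_simps)
      also have "\<dots> = d / 2"
        by (smt (verit) h_def norm_ge_zero nonzero_mult_div_cancel_right times_divide_eq_left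
            mult.commute mult.left_commute field_sum_of_halves mult_2 divide_divide_eq_left)
      also have "\<dots> < d" using \<open>d > 0\<close> by simp
      finally show ?thesis by (simp add: dist_norm algebra_simps)
    qed
    have near': "dist (x + s *\<^sub>R v + t *\<^sub>R u) x < d" if "s \<in> {0..h}" "t \<in> {0..h}" for s t
      using near[OF that(2,1)] by (simp add: algebra_simps)
    have dif: "f differentiable (at y)" "(\<lambda>x. frechet_derivative f (at x) a) differentiable (at y)"
      if "dist y x < d" for y a
      using d3(2)[of y] that smooth_on_imp_differentiable[OF assms(2,1)]
        smooth_on_imp_differentiable[OF smooth_on_derivative[OF assms(2)] assms(1)]
      by (auto simp: d_def)
    obtain s t where st: "s \<in> {0..h}" "t \<in> {0..h}"
      "f (x + h *\<^sub>R u + h *\<^sub>R v) - f (x + h *\<^sub>R u) - f (x + h *\<^sub>R v) + f x = h * (h * ?uv (x + s *\<^sub>R u + t *\<^sub>R v))"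
      by (rule mixed_difference_mean_value[OF \<open>h > 0\<close>, of f x u v])
        (intro dif near; assumption)+
    obtain s' t' where st': "s' \<in> {0..h}" "t' \<in> {0..h}"
      "f (x + h *\<^sub>R v + h *\<^sub>R u) - f (x + h *\<^sub>R v) - f (x + h *\<^sub>R u) + f x = h * (h * ?vu (x + s' *\<^sub>R v + t' *\<^sub>R u))"
      by (rule mixed_difference_mean_value[OF \<open>h > 0\<close>, of f x v u])
        (intro dif near'; assumption)+
    have "h * (h * ?uv (x + s *\<^sub>R u + t *\<^sub>R v)) = h * (h * ?vu (x + s' *\<^sub>R v + t' *\<^sub>R u))"
      using st(3) st'(3) by (simp add: algebra_simps)
    then have "?uv (x + s *\<^sub>R u + t *\<^sub>R v) = ?vu (x + s' *\<^sub>R v + t' *\<^sub>R u)"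
      using \<open>h > 0\<close> by simp
    moreover have "\<bar>?uv (x + s *\<^sub>R u + t *\<^sub>R v) - ?uv x\<bar> < e / 2"
      using d1(2) near[OF st(1,2)] unfolding d_def by simp
    moreover have "\<bar>?vu (x + s' *\<^sub>R v + t' *\<^sub>R u) - ?vu x\<bar> < e / 2"
      using d2(2) near'[OF st'(1,2)] unfolding d_def by simp
    ultimately show ?thesis by linarith
  qed
  then show ?thesis
    by (metis abs_le_zero_iff dense_ge eq_iff_diff_eq_0)
qed

lemma second_derivative_symmetric:
  fixes f :: "'a::euclidean_space \<Rightarrow> 'b::euclidean_space"
  assumes "open S" "smooth_on S f" "x \<in> S"
  shows "frechet_derivative (\<lambda>x. frechet_derivative f (at x) u) (at x) v
       = frechet_derivative (\<lambda>x. frechet_derivative f (at x) v) (at x) u"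
proof (rule euclidean_eqI)
  fix b :: 'b assume "b \<in> Basis"
  have comp: "frechet_derivative (\<lambda>x. h x \<bullet> b) (at y) w = frechet_derivative h (at y) w \<bullet> b"
    if "smooth_on S h" "y \<in> S" for h :: "'a \<Rightarrow> 'b" and y w
    using that bounded_linear.has_derivative[OF bounded_linear_inner_left, of h _ "at y" b]
      smooth_on_imp_differentiable[OF that(1) assms(1) that(2)]
    by (metis frechet_derivative_at frechet_derivative_works)
  have smb: "smooth_on S (\<lambda>x. h x \<bullet> b)" if "smooth_on S h" for h :: "'a \<Rightarrow> 'b"
    by (rule smooth_on_bilinear[OF bounded_bilinear_inner assms(1) that smooth_on_const])
  have two: "frechet_derivative (\<lambda>x. frechet_derivative f (at x) a) (at x) c \<bullet> b
      = frechet_derivative (\<lambda>x. frechet_derivative (\<lambda>x. f x \<bullet> b) (at x) a) (at x) c" for a c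
  proof -
    have "frechet_derivative (\<lambda>x. frechet_derivative f (at x) a) (at x) c \<bullet> b
      = frechet_derivative (\<lambda>x. frechet_derivative f (at x) a \<bullet> b) (at x) c"
      by (rule comp[symmetric, OF smooth_on_derivative[OF assms(2)] assms(3)])
    also have "\<dots> = frechet_derivative (\<lambda>x. frechet_derivative (\<lambda>x. f x \<bullet> b) (at x) a) (at x) c"
      using comp[OF assms(2)]
      by (subst frechet_derivative_transform_within_open[OF _ assms(1,3)])
        (auto intro!: smooth_on_imp_differentiable[OF _ assms(1,3)] smb smooth_on_derivative assms(2))
    finally show ?thesis .
  qed
  show "frechet_derivative (\<lambda>x. frechet_derivative f (at x) u) (at x) v \<bullet> b
       = frechet_derivative (\<lambda>x. frechet_derivative f (at x) v) (at x) u \<bullet> b"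
    unfolding two by (rule second_derivative_symmetric_real[OF assms(1) smb[OF assms(2)] assms(3)])
qed

text \<open>The derivative of \<open>V f\<close> in direction \<open>u\<close>. The second-order term is the symmetric Hessian of
\<open>f\<close> at \<open>(u, V x)\<close>, so that it drops out of the commutator of two vector fields.\<close>

lemma frechet_derivative_derivative_apply:
  fixes f :: "'a::euclidean_space \<Rightarrow> 'b::euclidean_space"
  assumes "open S" "smooth_on S f" "smooth_on S V" "x \<in> S"
  shows "frechet_derivative (\<lambda>y. frechet_derivative f (at y) (V y)) (at x) u
       = frechet_derivative (\<lambda>y. frechet_derivative f (at y) u) (at x) (V x)
         + frechet_derivative f (at x) (frechet_derivative V (at x) u)"
proof -
  let ?D = "\<lambda>b y. frechet_derivative f (at y) b"
  have lin: "linear (frechet_derivative f (at y))" if "y \<in> S" for y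
    by (rule linear_frechet_derivative[OF smooth_on_imp_differentiable[OF assms(2,1) that]])
  have hD: "(?D b has_derivative frechet_derivative (?D b) (at x)) (at x)" for b
    using smooth_on_imp_differentiable[OF smooth_on_derivative[OF assms(2)] assms(1,4)]
    by (simp add: frechet_derivative_works)
  have hV: "(V has_derivative frechet_derivative V (at x)) (at x)"
    using smooth_on_imp_differentiable[OF assms(3,1,4)] by (simp add: frechet_derivative_works)
  have "((\<lambda>y. \<Sum>b\<in>Basis. (V y \<bullet> b) *\<^sub>R ?D b y) has_derivative
      (\<lambda>w. \<Sum>b\<in>Basis. (V x \<bullet> b) *\<^sub>R frechet_derivative (?D b) (at x) w
        + (frechet_derivative V (at x) w \<bullet> b) *\<^sub>R ?D b x)) (at x)"
    by (intro has_derivative_sum has_derivative_scaleR hD has_derivative_inner_left hV)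
  then have "((\<lambda>y. frechet_derivative f (at y) (V y)) has_derivative
      (\<lambda>w. \<Sum>b\<in>Basis. (V x \<bullet> b) *\<^sub>R frechet_derivative (?D b) (at x) w
        + (frechet_derivative V (at x) w \<bullet> b) *\<^sub>R ?D b x)) (at x)"
    by (rule has_derivative_transform_within_open[OF _ assms(1,4)])
      (rule linear_Basis_expansion[OF lin, symmetric])
  from fun_cong[OF frechet_derivative_at[OF this, symmetric], of u]
  have "frechet_derivative (\<lambda>y. frechet_derivative f (at y) (V y)) (at x) u
      = (\<Sum>b\<in>Basis. (V x \<bullet> b) *\<^sub>R frechet_derivative (?D b) (at x) u)
        + (\<Sum>b\<in>Basis. (frechet_derivative V (at x) u \<bullet> b) *\<^sub>R ?D b x)"
    by (simp add: sum.distrib)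
  also have "(\<Sum>b\<in>Basis. (frechet_derivative V (at x) u \<bullet> b) *\<^sub>R ?D b x)
      = frechet_derivative f (at x) (frechet_derivative V (at x) u)"
    by (rule linear_Basis_expansion[OF lin[OF assms(4)], symmetric])
  also have "(\<Sum>b\<in>Basis. (V x \<bullet> b) *\<^sub>R frechet_derivative (?D b) (at x) u)
      = (\<Sum>b\<in>Basis. (V x \<bullet> b) *\<^sub>R frechet_derivative (?D u) (at x) b)"
    by (simp only: second_derivative_symmetric[OF assms(1,2,4), of _ u])
  also have "\<dots> = frechet_derivative (?D u) (at x) (V x)"
    by (rule linear_Basis_expansion[OF has_derivative_linear[OF hD], symmetric])
  finally show ?thesis .
qed

section \<open>Smooth bump functions\<close>

text \<open>The polynomial factor makes this family closed under differentiation, so that smoothness of \<open>exp (-1/t)\<close>, continued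
by \<open>0\<close>, follows by induction on the order.\<close>
definition flat_at_0 :: "real poly \<Rightarrow> real \<Rightarrow> real" where
  "flat_at_0 p t = (if t > 0 then poly p (inverse t) * exp (- inverse t) else 0)"

lemma flat_at_0_tendsto: "(flat_at_0 p \<longlongrightarrow> 0) (at 0)"
proof -
  have "((\<lambda>x. \<Sum>i\<le>degree p. coeff p i * (x ^ i / exp x)) \<longlongrightarrow> (\<Sum>i\<le>degree p. coeff p i * 0)) at_top"
    by (intro tendsto_sum tendsto_mult tendsto_const tendsto_power_div_exp_0)
  moreover have "(\<Sum>i\<le>degree p. coeff p i * (x ^ i / exp x)) = poly p x * exp (- x)" for x :: real
    by (simp add: poly_altdef sum_distrib_right exp_minus divide_inverse mult.assoc)
  ultimately have "((\<lambda>x. poly p x * exp (- x)) \<longlongrightarrow> 0) at_top"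
    by simp
  from filterlim_compose[OF this filterlim_inverse_at_top_right]
  have "((\<lambda>t. poly p (inverse t) * exp (- inverse t)) \<longlongrightarrow> 0) (at_right 0)" .
  then have "(flat_at_0 p \<longlongrightarrow> 0) (at_right 0)"
    by (rule Lim_transform_eventually) (auto simp: eventually_at_filter flat_at_0_def)
  moreover have "(flat_at_0 p \<longlongrightarrow> 0) (at_left 0)"
    by (rule Lim_transform_eventually[OF tendsto_const])
      (auto simp: eventually_at_filter flat_at_0_def)
  ultimately show ?thesis by (simp add: filterlim_at_split)
qed

text \<open>At \<open>0\<close> the difference quotient of a member of the family is again a member, hence tends to \<open>0\<close>.\<close>

lemma flat_at_0_has_derivative:
  "(flat_at_0 p has_real_derivative flat_at_0 ([:0, 0, 1:] * (p - pderiv p)) t) (at t)"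
proof -
  consider "t > 0" | "t < 0" | "t = 0" by linarith
  then show ?thesis
  proof cases
    case 1
    have "((\<lambda>t. poly p (inverse t) * exp (- inverse t)) has_real_derivative
        flat_at_0 ([:0, 0, 1:] * (p - pderiv p)) t) (at t)"
      using 1 by (auto intro!: derivative_eq_intros DERIV_chain2[OF poly_DERIV]
          simp: flat_at_0_def algebra_simps power2_eq_square)
    then show ?thesis
      by (rule has_field_derivative_transform_within_open[where S = "{0<..}"])
        (use 1 in \<open>auto simp: flat_at_0_def\<close>)
  next
    case 2
    have "((\<lambda>t. 0) has_real_derivative flat_at_0 ([:0, 0, 1:] * (p - pderiv p)) t) (at t)"
      using 2 by (simp add: flat_at_0_def)
    then show ?thesis
      by (rule has_field_derivative_transform_within_open[where S = "{..<0}"])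
        (use 2 in \<open>auto simp: flat_at_0_def\<close>)
  next
    case 3
    have "(\<lambda>h. (flat_at_0 p (0 + h) - flat_at_0 p 0) / h) = flat_at_0 (pCons 0 p)"
      by (auto simp: flat_at_0_def field_simps)
    moreover have "flat_at_0 q 0 = 0" for q by (simp add: flat_at_0_def)
    ultimately show ?thesis
      using flat_at_0_tendsto[of "pCons 0 p"] unfolding 3 DERIV_def by simp
  qed
qed

lemma smooth_on_flat_at_0: "smooth_on UNIV (flat_at_0 p)"
proof -
  have "Ck_on k (flat_at_0 p) UNIV" for k
  proof (induction k arbitrary: p)
    case 0
    then show ?case
      using flat_at_0_has_derivative by (auto intro!: DERIV_continuous_on)
  next
    case (Suc k)
    show ?case
    proof (rule Ck_on_SucI[OF open_UNIV])
      show "(flat_at_0 p has_derivative (\<lambda>v. flat_at_0 ([:0, 0, 1:] * (p - pderiv p)) t * v)) (at t)" for t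
        using flat_at_0_has_derivative[of p t] unfolding has_field_derivative_def .
      show "Ck_on k (\<lambda>t. flat_at_0 ([:0, 0, 1:] * (p - pderiv p)) t * v) UNIV" for v
        by (rule Ck_on_bilinear[OF bounded_bilinear_mult open_UNIV Suc.IH Ck_on_const])
    qed
  qed
  then show ?thesis by (simp add: smooth_on_def)
qed

lemma smooth_bump_function:
  fixes c :: "'a::euclidean_space"
  assumes "r > 0"
  obtains \<beta> :: "'a \<Rightarrow> real"
  where "smooth_on UNIV \<beta>" "\<beta> c = 1" "\<And>x. x \<notin> cball c r \<Longrightarrow> \<beta> x = 0"
proof
  let ?s = "\<lambda>x. r\<^sup>2 - (x - c) \<bullet> (x - c)"
  let ?b = "\<lambda>x. inverse (flat_at_0 1 (r\<^sup>2)) * flat_at_0 1 (?s x)"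
  have sub: "smooth_on UNIV (\<lambda>x. x - c)"
    using smooth_on_add[OF open_UNIV smooth_on_ident smooth_on_const[of _ "- c"]] by simp
  have "smooth_on UNIV (\<lambda>x. r\<^sup>2 + -1 * ((x - c) \<bullet> (x - c)))"
    by (rule smooth_on_add[OF open_UNIV smooth_on_const
          smooth_on_bilinear[OF bounded_bilinear_mult open_UNIV smooth_on_const
            smooth_on_bilinear[OF bounded_bilinear_inner open_UNIV sub sub]]])
  then have "smooth_on UNIV ?s" by simp
  then have "smooth_on UNIV (\<lambda>x. flat_at_0 1 (?s x))"
    using smooth_on_compose[OF open_UNIV open_UNIV _ smooth_on_flat_at_0, of ?s 1] by simp
  then show "smooth_on UNIV ?b"
    by (rule smooth_on_bilinear[OF bounded_bilinear_mult open_UNIV smooth_on_const])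
  show "?b c = 1" using assms by (simp add: flat_at_0_def)
  show "?b x = 0" if "x \<notin> cball c r" for x
  proof -
    have "r < norm (x - c)" using that by (simp add: dist_norm norm_minus_commute)
    then have "r\<^sup>2 < (norm (x - c))\<^sup>2" using assms by (intro power_strict_mono) auto
    then show ?thesis by (simp add: flat_at_0_def power2_norm_eq_inner)
  qed
qed

section \<open>Derivatives of functions on a manifold\<close>

locale smooth_manifold =
  fixes A :: "('m::{t2_space,second_countable_topology}, 'e::euclidean_space) chart set"
  assumes atlas: "smooth_atlas A"
begin

lemma chart:
  assumes "(U, \<phi>) \<in> A"
  shows chart_open: "open U" and chart_image_open: "open (\<phi> ` U)"
    and chart_homeomorphism: "homeomorphism U (\<phi> ` U) \<phi> (inv_into U \<phi>)"
  using atlas assms unfolding smooth_atlas_def by blast+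

lemma transition_smooth:
  "(U, \<phi>) \<in> A \<Longrightarrow> (V, \<psi>) \<in> A \<Longrightarrow> smooth_on (\<phi> ` (U \<inter> V)) (\<psi> \<circ> inv_into U \<phi>)"
  using atlas unfolding smooth_atlas_def by blast

lemma chart_inv: "(U, \<phi>) \<in> A \<Longrightarrow> p \<in> U \<Longrightarrow> inv_into U \<phi> (\<phi> p) = p"
  using homeomorphism_apply1[OF chart_homeomorphism] by blast

lemma chart_image_Int_open:
  assumes "(U, \<phi>) \<in> A" "open W"
  shows "open (\<phi> ` (U \<inter> W))"
proof -
  have "openin (top_of_set U) (U \<inter> W)"
    using assms(2) by blast
  then have "openin (top_of_set (\<phi> ` U)) (\<phi> ` (U \<inter> W))"
    by (rule homeomorphism_imp_open_map[OF chart_homeomorphism[OF assms(1)]])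
  then show ?thesis
    using chart_image_open[OF assms(1)] openin_open_trans by blast
qed

lemma chart_at_obtain:
  obtains U \<phi> where "chart_at A p = (U, \<phi>)" "(U, \<phi>) \<in> A" "p \<in> U"
proof -
  have "(\<Union>(U, \<phi>)\<in>A. U) = UNIV"
    using atlas by (simp only: smooth_atlas_def)
  then have "p \<in> (\<Union>(U, \<phi>)\<in>A. U)" by (simp only: UNIV_I)
  then have "\<exists>c. c \<in> A \<and> p \<in> fst c" by (auto simp: Bex_def)
  from someI_ex[OF this] have "chart_at A p \<in> A \<and> p \<in> fst (chart_at A p)"
    unfolding chart_at_def .
  then show thesis
    using that by (cases "chart_at A p") auto
qed

text \<open>Chart maps are smooth on their domains only, so global smoothness is not enough: vector fields are compared by letting them act on
chart maps.\<close>
definition smooth_map_on :: "'m set \<Rightarrow> ('m \<Rightarrow> 'b::real_normed_vector) \<Rightarrow> bool" where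
  "smooth_map_on W f \<longleftrightarrow> (\<forall>(U, \<phi>)\<in>A. smooth_on (\<phi> ` (U \<inter> W)) (f \<circ> inv_into U \<phi>))"

lemma smooth_map_iff: "smooth_map A f \<longleftrightarrow> smooth_map_on UNIV f"
  by (simp add: smooth_map_def smooth_map_on_def)

lemma smooth_map_onD:
  "smooth_map_on W f \<Longrightarrow> (U, \<phi>) \<in> A \<Longrightarrow> smooth_on (\<phi> ` (U \<inter> W)) (f \<circ> inv_into U \<phi>)"
  unfolding smooth_map_on_def by blast

lemma smooth_map_on_differentiable:
  assumes "smooth_map_on W f" "open W" "(U, \<phi>) \<in> A" "p \<in> U" "p \<in> W"
  shows "(f \<circ> inv_into U \<phi>) differentiable (at (\<phi> p))"
  using smooth_on_imp_differentiable[OF smooth_map_onD[OF assms(1,3)]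
      chart_image_Int_open[OF assms(3,2)]] assms(4,5) by blast

lemma smooth_map_on_chart: "(V, \<psi>) \<in> A \<Longrightarrow> smooth_map_on V \<psi>"
  unfolding smooth_map_on_def using transition_smooth by blast

lemma smooth_map_on_cong:
  assumes "open W" "smooth_map_on W f" "\<And>p. p \<in> W \<Longrightarrow> f p = h p"
  shows "smooth_map_on W h"
  unfolding smooth_map_on_def
proof clarify
  fix U \<phi> assume c: "(U, \<phi>) \<in> A"
  show "smooth_on (\<phi> ` (U \<inter> W)) (h \<circ> inv_into U \<phi>)"
    by (rule smooth_on_cong[OF chart_image_Int_open[OF c assms(1)] smooth_map_onD[OF assms(2) c]])
      (auto simp: chart_inv[OF c] assms(3))
qed

lemma smooth_map_on_const: "smooth_map_on W (\<lambda>p. c)"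
  unfolding smooth_map_on_def o_def by (auto intro: smooth_on_const)

lemma smooth_map_on_add:
  assumes "open W" "smooth_map_on W f" "smooth_map_on W h"
  shows "smooth_map_on W (\<lambda>p. f p + h p)"
  unfolding smooth_map_on_def
proof clarify
  fix U \<phi> assume c: "(U, \<phi>) \<in> A"
  show "smooth_on (\<phi> ` (U \<inter> W)) ((\<lambda>p. f p + h p) \<circ> inv_into U \<phi>)"
    using smooth_on_add[OF chart_image_Int_open[OF c assms(1)] smooth_map_onD[OF assms(2) c]
        smooth_map_onD[OF assms(3) c]] by (simp add: o_def)
qed

lemma smooth_map_on_bilinear:
  assumes "bounded_bilinear b" "open W" "smooth_map_on W f" "smooth_map_on W h"
  shows "smooth_map_on W (\<lambda>p. b (f p) (h p))"
  unfolding smooth_map_on_def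
proof clarify
  fix U \<phi> assume c: "(U, \<phi>) \<in> A"
  show "smooth_on (\<phi> ` (U \<inter> W)) ((\<lambda>p. b (f p) (h p)) \<circ> inv_into U \<phi>)"
    using smooth_on_bilinear[OF assms(1) chart_image_Int_open[OF c assms(2)] smooth_map_onD[OF assms(3) c]
        smooth_map_onD[OF assms(4) c]] by (simp add: o_def)
qed

lemma smooth_map_on_diff:
  assumes "open W" "smooth_map_on W f" "smooth_map_on W h"
  shows "smooth_map_on W (\<lambda>p. f p - h p)"
  using smooth_map_on_add[OF assms(1,2) smooth_map_on_bilinear[OF bounded_bilinear_scaleR assms(1)
        smooth_map_on_const[of W "-1"] assms(3)]] by simp

text \<open>The chain rule for the change from \<open>chart_at A p\<close> to \<open>\<phi>\<close>. It frees \<open>diff_at\<close> from the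
arbitrary choice of \<open>chart_at\<close>, and is what allows derivatives to be studied near a point in one chart.\<close>

lemma diff_at_chart_change:
  assumes "(U, \<phi>) \<in> A" "p \<in> U" and f: "(f \<circ> inv_into U \<phi>) differentiable (at (\<phi> p))"
  shows "diff_at A f p v = frechet_derivative (f \<circ> inv_into U \<phi>) (at (\<phi> p)) (diff_at A \<phi> p v)"
    (is "_ = frechet_derivative ?f _ _")
proof -
  obtain V \<psi> where V: "chart_at A p = (V, \<psi>)" "(V, \<psi>) \<in> A" "p \<in> V"
    by (rule chart_at_obtain)
  let ?\<tau> = "\<phi> \<circ> inv_into V \<psi>"
  have \<tau>: "?\<tau> differentiable (at (\<psi> p))"
    using smooth_map_on_differentiable[OF smooth_map_on_chart[OF assms(1)] chart_open[OF assms(1)] V(2,3) assms(2)] .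
  have \<tau>p: "?\<tau> (\<psi> p) = \<phi> p" by (simp add: chart_inv V)
  have "((?f \<circ> ?\<tau>) has_derivative (frechet_derivative ?f (at (\<phi> p)) \<circ> frechet_derivative ?\<tau> (at (\<psi> p))))
      (at (\<psi> p))"
    using \<tau> f by (intro diff_chain_at) (simp_all add: frechet_derivative_works[symmetric] \<tau>p del: o_apply)
  then have "((f \<circ> inv_into V \<psi>) has_derivative
      (frechet_derivative ?f (at (\<phi> p)) \<circ> frechet_derivative ?\<tau> (at (\<psi> p)))) (at (\<psi> p))"
  proof (rule has_derivative_transform_within_open)
    show "open (\<psi> ` (V \<inter> U))" by (rule chart_image_Int_open[OF V(2) chart_open[OF assms(1)]])
    show "\<psi> p \<in> \<psi> ` (V \<inter> U)" using V assms(2) by blast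
  qed (auto simp: chart_inv[OF V(2)] chart_inv[OF assms(1)])
  from frechet_derivative_at[OF this, symmetric] show ?thesis
    by (simp add: diff_at_def V)
qed

text \<open>Tangent vectors at \<open>p\<close> are represented by their coordinates in \<open>chart_at A p\<close>; hence a vector is
recovered from its action on the coordinate map of that chart.\<close>

lemma diff_at_chart_at: "diff_at A (snd (chart_at A p)) p v = v"
proof -
  obtain U \<phi> where c: "chart_at A p = (U, \<phi>)" "(U, \<phi>) \<in> A" "p \<in> U"
    by (rule chart_at_obtain)
  have "((\<phi> \<circ> inv_into U \<phi>) has_derivative (\<lambda>v. v)) (at (\<phi> p))"
    by (rule has_derivative_transform_within_open[OF has_derivative_ident chart_image_open[OF c(2)]])
      (auto simp: c chart_inv[OF c(2)])
  from frechet_derivative_at[OF this, symmetric] show ?thesis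
    by (simp add: diff_at_def c)
qed

lemma diff_at_works:
  assumes "smooth_map_on W f" "open W" "p \<in> W"
  shows "(f \<circ> inv_into (fst (chart_at A p)) (snd (chart_at A p)) has_derivative diff_at A f p)
      (at (snd (chart_at A p) p))"
proof -
  obtain U \<phi> where c: "chart_at A p = (U, \<phi>)" "(U, \<phi>) \<in> A" "p \<in> U"
    by (rule chart_at_obtain)
  then show ?thesis
    using smooth_map_on_differentiable[OF assms(1,2) c(2,3) assms(3)]
    by (simp add: frechet_derivative_works diff_at_def[abs_def])
qed

lemma diff_at_unique:
  assumes "(f \<circ> inv_into (fst (chart_at A p)) (snd (chart_at A p)) has_derivative D)
      (at (snd (chart_at A p) p))"
  shows "diff_at A f p v = D v"
  using fun_cong[OF frechet_derivative_at[OF assms], of v]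
  by (simp add: diff_at_def case_prod_beta)

lemma linear_diff_at: "smooth_map_on W f \<Longrightarrow> open W \<Longrightarrow> p \<in> W \<Longrightarrow> linear (diff_at A f p)"
  using has_derivative_linear[OF diff_at_works] .

lemma chart_at_point: "inv_into (fst (chart_at A p)) (snd (chart_at A p)) (snd (chart_at A p) p) = p"
proof -
  obtain U \<phi> where c: "chart_at A p = (U, \<phi>)" "(U, \<phi>) \<in> A" "p \<in> U"
    by (rule chart_at_obtain)
  then show ?thesis using chart_inv by simp
qed

lemma diff_at_const: "diff_at A (\<lambda>p. c) p v = 0"
  by (rule diff_at_unique) (simp add: o_def)

lemma diff_at_add:
  assumes "open W" "smooth_map_on W f" "smooth_map_on W h" "p \<in> W"
  shows "diff_at A (\<lambda>p. f p + h p) p v = diff_at A f p v + diff_at A h p v"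
  using has_derivative_add[OF diff_at_works[OF assms(2,1,4)] diff_at_works[OF assms(3,1,4)]]
  by (intro diff_at_unique) (simp add: o_def)

lemma diff_at_bilinear:
  assumes "bounded_bilinear b" "open W" "smooth_map_on W f" "smooth_map_on W h" "p \<in> W"
  shows "diff_at A (\<lambda>p. b (f p) (h p)) p v = b (f p) (diff_at A h p v) + b (diff_at A f p v) (h p)"
  using bounded_bilinear.FDERIV[OF assms(1) diff_at_works[OF assms(3,2,5)] diff_at_works[OF assms(4,2,5)]]
  by (intro diff_at_unique) (simp add: o_def chart_at_point)

lemma diff_at_cong:
  assumes "open W" "smooth_map_on W f" "\<And>q. q \<in> W \<Longrightarrow> f q = h q" "p \<in> W"
  shows "diff_at A f p v = diff_at A h p v"
proof -
  obtain U \<phi> where c: "chart_at A p = (U, \<phi>)" "(U, \<phi>) \<in> A" "p \<in> U"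
    by (rule chart_at_obtain)
  have "(f \<circ> inv_into U \<phi> has_derivative diff_at A f p) (at (\<phi> p))"
    using diff_at_works[OF assms(2,1,4)] c by simp
  then have "(h \<circ> inv_into U \<phi> has_derivative diff_at A f p) (at (\<phi> p))"
    by (rule has_derivative_transform_within_open[OF _ chart_image_Int_open[OF c(2) assms(1)]])
      (use c assms(3,4) in \<open>auto simp: chart_inv[OF c(2)]\<close>)
  then show ?thesis
    using diff_at_unique[of h p] c by simp
qed

definition directional :: "('m \<Rightarrow> 'e) \<Rightarrow> ('m \<Rightarrow> 'b::real_normed_vector) \<Rightarrow> 'm \<Rightarrow> 'b" where
  "directional X f p = diff_at A f p (X p)"

lemma vf_apply_eq: "vf_apply A X f = directional X f"
  by (auto simp: vf_apply_def directional_def)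

text \<open>The coordinates of \<open>X\<close> in the chart \<open>c\<close>, as a function of the coordinates of the point.\<close>
definition components :: "('m \<Rightarrow> 'e) \<Rightarrow> ('m, 'e) chart \<Rightarrow> 'e \<Rightarrow> 'e" where
  "components X c = directional X (snd c) \<circ> inv_into (fst c) (snd c)"

lemma components_smooth:
  "X \<in> vf A \<Longrightarrow> (U, \<phi>) \<in> A \<Longrightarrow> smooth_on (\<phi> ` U) (components X (U, \<phi>))"
  unfolding vf_def components_def directional_def[abs_def] by auto

text \<open>Coordinates of a vector field in a chart are smooth with respect to all other charts too. This form of membership in \<open>vf
A\<close> is preserved by pointwise operations.\<close>

lemma vf_iff: "X \<in> vf A \<longleftrightarrow> (\<forall>(U, \<phi>)\<in>A. smooth_map_on U (directional X \<phi>))"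
proof
  assume X: "\<forall>(U, \<phi>)\<in>A. smooth_map_on U (directional X \<phi>)"
  have "smooth_on (\<phi> ` U) (directional X \<phi> \<circ> inv_into U \<phi>)" if "(U, \<phi>) \<in> A" for U \<phi>
    using X that smooth_map_onD[of U "directional X \<phi>" U \<phi>] by auto
  then show "X \<in> vf A" unfolding vf_def directional_def[abs_def] by blast
next
  assume X: "X \<in> vf A"
  show "\<forall>(U, \<phi>)\<in>A. smooth_map_on U (directional X \<phi>)"
    unfolding smooth_map_on_def
  proof clarify
    fix U \<phi> V \<psi> assume c: "(U, \<phi>) \<in> A" "(V, \<psi>) \<in> A"
    have o: "open (\<psi> ` (V \<inter> U))" by (rule chart_image_Int_open[OF c(2) chart_open[OF c(1)]])
    have "smooth_on (\<psi> ` (V \<inter> U)) (\<lambda>y. frechet_derivative (\<phi> \<circ> inv_into V \<psi>) (at y) (components X (V, \<psi>) y))"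
      by (rule smooth_on_derivative_apply[OF o transition_smooth[OF c(2,1)]
            smooth_on_subset[OF components_smooth[OF X c(2)]]]) blast
    then show "smooth_on (\<psi> ` (V \<inter> U)) (directional X \<phi> \<circ> inv_into V \<psi>)"
    proof (rule smooth_on_cong[OF o])
      fix y assume "y \<in> \<psi> ` (V \<inter> U)"
      then obtain p where p: "p \<in> V" "p \<in> U" "y = \<psi> p" by blast
      show "frechet_derivative (\<phi> \<circ> inv_into V \<psi>) (at y) (components X (V, \<psi>) y)
          = (directional X \<phi> \<circ> inv_into V \<psi>) y"
        using diff_at_chart_change[OF c(2) p(1), of \<phi> "X p"]
          smooth_map_on_differentiable[OF smooth_map_on_chart[OF c(1)] chart_open[OF c(1)] c(2) p(1,2)]
        by (simp add: components_def directional_def p chart_inv[OF c(2)])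
    qed
  qed
qed

lemma directional_in_chart:
  assumes "smooth_map_on W f" "open W" "(U, \<phi>) \<in> A" "p \<in> U" "p \<in> W"
  shows "directional X f p = frechet_derivative (f \<circ> inv_into U \<phi>) (at (\<phi> p)) (components X (U, \<phi>) (\<phi> p))"
  using diff_at_chart_change[OF assms(3,4) smooth_map_on_differentiable[OF assms]]
  by (simp add: directional_def components_def chart_inv[OF assms(3,4)])

lemma smooth_map_on_directional:
  assumes "X \<in> vf A" "open W" "smooth_map_on W f"
  shows "smooth_map_on W (directional X f)"
  unfolding smooth_map_on_def
proof clarify
  fix U \<phi> assume c: "(U, \<phi>) \<in> A"
  note o = chart_image_Int_open[OF c assms(2)]
  have "smooth_on (\<phi> ` (U \<inter> W)) (\<lambda>y. frechet_derivative (f \<circ> inv_into U \<phi>) (at y) (components X (U, \<phi>) y))"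
    by (rule smooth_on_derivative_apply[OF o smooth_map_onD[OF assms(3) c]
          smooth_on_subset[OF components_smooth[OF assms(1) c]]]) blast
  then show "smooth_on (\<phi> ` (U \<inter> W)) (directional X f \<circ> inv_into U \<phi>)"
    by (rule smooth_on_cong[OF o])
      (auto simp: chart_inv[OF c] directional_in_chart[OF assms(3,2) c] simp del: o_apply
        simp: comp_apply[of "directional X f"])
qed

section \<open>The Lie bracket\<close>

text \<open>In the coordinates of \<open>chart_at A p\<close> both iterated derivatives are given by
\<open>frechet_derivative_derivative_apply\<close>; the Hessian terms cancel by symmetry and the remaining first-order terms are
the coordinate formula that defines the bracket. Allowing \<open>f\<close> to be smooth only near \<open>p\<close> makes the
formula applicable to coordinate maps.\<close>

lemma directional_lie_bracket:
  fixes f :: "'m \<Rightarrow> 'b::euclidean_space"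
  assumes X: "X \<in> vf A" and Y: "Y \<in> vf A" and W: "open W" "smooth_map_on W f" "p \<in> W"
  shows "directional (lie_bracket A X Y) f p
       = directional X (directional Y f) p - directional Y (directional X f) p"
proof -
  obtain U \<phi> where c: "chart_at A p = (U, \<phi>)" "(U, \<phi>) \<in> A" "p \<in> U"
    by (rule chart_at_obtain)
  let ?f = "f \<circ> inv_into U \<phi>" and ?x = "\<phi> p"
  let ?S = "\<phi> ` (U \<inter> W)"
  have o: "open ?S" by (rule chart_image_Int_open[OF c(2) W(1)])
  have x: "?x \<in> ?S" using c W by blast
  have comp: "smooth_on ?S (components Z (U, \<phi>))" if "Z \<in> vf A" for Z
    by (rule smooth_on_subset[OF components_smooth[OF that c(2)]]) blast
  have at_p: "components Z (U, \<phi>) ?x = Z p" for Z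
    using diff_at_chart_at[of p "Z p"] c by (simp add: components_def directional_def chart_inv[OF c(2)])
  have second: "directional Z (directional Z' f) p
      = frechet_derivative (\<lambda>y. frechet_derivative ?f (at y) (Z p)) (at ?x) (Z' p)
        + frechet_derivative ?f (at ?x) (frechet_derivative (components Z' (U, \<phi>)) (at ?x) (Z p))"
    if Z: "Z \<in> vf A" "Z' \<in> vf A" for Z Z'
  proof -
    have "directional Z (directional Z' f) p
        = frechet_derivative (directional Z' f \<circ> inv_into U \<phi>) (at ?x) (Z p)"
      by (simp add: directional_def diff_at_def c)
    also have "frechet_derivative (directional Z' f \<circ> inv_into U \<phi>) (at ?x)
        = frechet_derivative (\<lambda>y. frechet_derivative ?f (at y) (components Z' (U, \<phi>) y)) (at ?x)"
    proof (rule frechet_derivative_transform_within_open[OF _ o x])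
      show "(directional Z' f \<circ> inv_into U \<phi>) differentiable (at ?x)"
        by (rule smooth_map_on_differentiable[OF smooth_map_on_directional[OF Z(2) W(1,2)] W(1) c(2,3) W(3)])
      show "(directional Z' f \<circ> inv_into U \<phi>) y = frechet_derivative ?f (at y) (components Z' (U, \<phi>) y)"
        if "y \<in> ?S" for y
        using that directional_in_chart[OF W(2,1) c(2)] by (auto simp: chart_inv[OF c(2)] comp_apply[of "directional Z' f"] simp del: o_apply)
    qed
    finally show ?thesis
      using frechet_derivative_derivative_apply[OF o smooth_map_onD[OF W(2) c(2)] comp[OF Z(2)] x, of "Z p"]
      by (simp add: at_p)
  qed
  have lin: "linear (frechet_derivative ?f (at ?x))"
    by (rule linear_frechet_derivative[OF smooth_map_on_differentiable[OF W(2,1) c(2,3) W(3)]])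
  have "lie_bracket A X Y p = frechet_derivative (components Y (U, \<phi>)) (at ?x) (X p)
      - frechet_derivative (components X (U, \<phi>)) (at ?x) (Y p)"
    by (simp add: lie_bracket_def components_def directional_def[abs_def] diff_at_def[of A _ p] c Let_def)
  then have "directional (lie_bracket A X Y) f p
      = frechet_derivative ?f (at ?x) (frechet_derivative (components Y (U, \<phi>)) (at ?x) (X p))
        - frechet_derivative ?f (at ?x) (frechet_derivative (components X (U, \<phi>)) (at ?x) (Y p))"
    using linear_diff[OF lin] by (simp add: directional_def diff_at_def[of A f] c)
  then show ?thesis
    using second[OF X Y] second[OF Y X]
      second_derivative_symmetric[OF o smooth_map_onD[OF W(2) c(2)] x, of "X p" "Y p"]
    by simp
qed

lemma vf_lie_bracket:
  assumes "X \<in> vf A" "Y \<in> vf A"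
  shows "lie_bracket A X Y \<in> vf A"
  unfolding vf_iff
proof clarify
  fix U \<phi> assume c: "(U, \<phi>) \<in> A"
  note o = chart_open[OF c]
  have "smooth_map_on U (\<lambda>p. directional X (directional Y \<phi>) p - directional Y (directional X \<phi>) p)"
    by (intro smooth_map_on_diff o smooth_map_on_directional assms smooth_map_on_chart c)
  then show "smooth_map_on U (directional (lie_bracket A X Y) \<phi>)"
    by (rule smooth_map_on_cong[OF o])
      (simp add: directional_lie_bracket[OF assms o smooth_map_on_chart[OF c]])
qed

text \<open>Vectors at \<open>p\<close> are determined by their action on the coordinate map \<open>\<phi>\<close> at \<open>p\<close>, and on
functions the identity is the one for commutators of operators.\<close>

lemma lie_bracket_Jacobi:
  assumes "X \<in> vf A" "Y \<in> vf A" "Z \<in> vf A"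
  shows "lie_bracket A X (lie_bracket A Y Z) p + lie_bracket A Y (lie_bracket A Z X) p
    + lie_bracket A Z (lie_bracket A X Y) p = 0"
proof -
  obtain U \<phi> where c: "chart_at A p = (U, \<phi>)" "(U, \<phi>) \<in> A" "p \<in> U"
    by (rule chart_at_obtain)
  note o = chart_open[OF c(2)] and s = smooth_map_on_chart[OF c(2)]
  have id: "directional V \<phi> p = V p" for V
    using diff_at_chart_at[of p] c by (simp add: directional_def)
  have *: "lie_bracket A L (lie_bracket A M N) p
      = directional L (directional M (directional N \<phi>)) p - directional L (directional N (directional M \<phi>)) p
       - (directional M (directional N (directional L \<phi>)) p - directional N (directional M (directional L \<phi>)) p)"
    if v: "L \<in> vf A" "M \<in> vf A" "N \<in> vf A" for L M N
  proof -
    note sm = smooth_map_on_directional[OF _ o]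
    note s1 = sm[OF _ s] and s2 = sm[OF _ sm[OF _ s]]
    have "directional L (directional (lie_bracket A M N) \<phi>) p
        = directional L (\<lambda>q. directional M (directional N \<phi>) q - directional N (directional M \<phi>) q) p"
      unfolding directional_def[of L]
      by (rule diff_at_cong[OF o s1[OF vf_lie_bracket[OF v(2,3)]] _ c(3)])
        (simp add: directional_lie_bracket[OF v(2,3) o s])
    also have "\<dots> = directional L (directional M (directional N \<phi>)) p
        - directional L (directional N (directional M \<phi>)) p"
      using diff_at_add[OF o s2[OF v(2,3)] smooth_map_on_bilinear[OF bounded_bilinear_scaleR o
            smooth_map_on_const[of U "-1"] s2[OF v(3,2)]] c(3)]
        diff_at_bilinear[OF bounded_bilinear_scaleR o smooth_map_on_const[of U "-1"] s2[OF v(3,2)] c(3)]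
      by (simp add: directional_def[of L] diff_at_const)
    finally show ?thesis
      using directional_lie_bracket[OF v(1) vf_lie_bracket[OF v(2,3)] o s c(3)]
        directional_lie_bracket[OF v(2,3) o s1[OF v(1)] c(3)]
      by (simp add: id)
  qed
  show ?thesis using *[OF assms] *[OF assms(2,3,1)] *[OF assms(3,1,2)] by simp
qed

lemma vf_add:
  assumes "X \<in> vf A" "Y \<in> vf A"
  shows "(\<lambda>p. X p + Y p) \<in> vf A"
  unfolding vf_iff
proof clarify
  fix U \<phi> assume c: "(U, \<phi>) \<in> A"
  note o = chart_open[OF c]
  have "smooth_map_on U (\<lambda>p. directional X \<phi> p + directional Y \<phi> p)"
    using assms c o by (auto simp: vf_iff intro!: smooth_map_on_add)
  then show "smooth_map_on U (directional (\<lambda>p. X p + Y p) \<phi>)"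
    by (rule smooth_map_on_cong[OF o])
      (simp add: directional_def linear_add[OF linear_diff_at[OF smooth_map_on_chart[OF c] o]])
qed

lemma vf_scaleR:
  assumes "smooth_map A f" "X \<in> vf A"
  shows "(\<lambda>p. f p *\<^sub>R X p) \<in> vf A"
  unfolding vf_iff
proof clarify
  fix U \<phi> assume c: "(U, \<phi>) \<in> A"
  note o = chart_open[OF c]
  have "smooth_map_on U f"
    using assms(1) unfolding smooth_map_def smooth_map_on_def
    by (blast intro: smooth_on_subset)
  then have "smooth_map_on U (\<lambda>p. f p *\<^sub>R directional X \<phi> p)"
    using assms(2) c o by (auto simp: vf_iff intro!: smooth_map_on_bilinear[OF bounded_bilinear_scaleR])
  then show "smooth_map_on U (directional (\<lambda>p. f p *\<^sub>R X p) \<phi>)"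
    by (rule smooth_map_on_cong[OF o])
      (simp add: directional_def linear_scale[OF linear_diff_at[OF smooth_map_on_chart[OF c] o]])
qed

section \<open>Extension of tangent vectors to vector fields\<close>

text \<open>The field that is constant in a chart, cut off by a bump function. Outside the compact support it is continued by zero; the
Hausdorff property makes the support closed, so that its complement and the chart domain form an open cover on whose parts
smoothness can be checked.\<close>

lemma vf_extension:
  obtains X where "X \<in> vf A" "X p = u"
proof -
  obtain U \<phi> where c: "chart_at A p = (U, \<phi>)" "(U, \<phi>) \<in> A" "p \<in> U"
    by (rule chart_at_obtain)
  note oU = chart_open[OF c(2)]
  obtain r where r: "r > 0" "cball (\<phi> p) r \<subseteq> \<phi> ` U"
    using chart_image_open[OF c(2)] c(3) by (meson image_eqI open_contains_cball)
  obtain \<beta> :: "'e \<Rightarrow> real" where \<beta>: "smooth_on UNIV \<beta>" "\<beta> (\<phi> p) = 1" "\<And>x. x \<notin> cball (\<phi> p) r \<Longrightarrow> \<beta> x = 0"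
    using smooth_bump_function[OF r(1)] by metis
  define K where "K = inv_into U \<phi> ` cball (\<phi> p) r"
  have "compact K"
    unfolding K_def
    by (intro compact_continuous_image continuous_on_subset[OF
          homeomorphism_cont2[OF chart_homeomorphism[OF c(2)]] r(2)] compact_cball)
  then have oK: "open (- K)" by (intro open_Compl compact_imp_closed)
  \<comment> \<open>\<open>X\<close> has coordinates \<open>\<beta> u\<close> in the chart \<open>\<phi>\<close>; its value at \<open>q\<close> has to
  be given in \<open>chart_at A q\<close>.\<close>
  define \<tau> where "\<tau> q = snd (chart_at A q) \<circ> inv_into U \<phi>" for q
  define X where "X q = (if q \<in> U then frechet_derivative (\<tau> q) (at (\<phi> q)) (\<beta> (\<phi> q) *\<^sub>R u) else 0)" for q
  have X_chart: "directional X \<psi> q = frechet_derivative (\<psi> \<circ> inv_into U \<phi>) (at (\<phi> q)) (\<beta> (\<phi> q) *\<^sub>R u)"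
    if d: "(V, \<psi>) \<in> A" "q \<in> V" "q \<in> U" for V \<psi> q
  proof -
    obtain T \<xi> where T: "chart_at A q = (T, \<xi>)" "(T, \<xi>) \<in> A" "q \<in> T"
      by (rule chart_at_obtain)
    let ?\<sigma> = "\<psi> \<circ> inv_into T \<xi>" and ?t = "\<xi> \<circ> inv_into U \<phi>"
    have t: "?t differentiable (at (\<phi> q))"
      using smooth_map_on_differentiable[OF smooth_map_on_chart[OF T(2)] chart_open[OF T(2)] c(2) d(3) T(3)] .
    have \<sigma>: "?\<sigma> differentiable (at (\<xi> q))"
      using smooth_map_on_differentiable[OF smooth_map_on_chart[OF d(1)] chart_open[OF d(1)] T(2,3) d(2)] .
    have tq: "?t (\<phi> q) = \<xi> q" by (simp add: chart_inv[OF c(2) d(3)])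
    have "((?\<sigma> \<circ> ?t) has_derivative (frechet_derivative ?\<sigma> (at (\<xi> q)) \<circ> frechet_derivative ?t (at (\<phi> q))))
        (at (\<phi> q))"
      using t \<sigma> by (intro diff_chain_at) (simp_all add: frechet_derivative_works[symmetric] tq del: o_apply)
    then have "((\<psi> \<circ> inv_into U \<phi>) has_derivative
        (frechet_derivative ?\<sigma> (at (\<xi> q)) \<circ> frechet_derivative ?t (at (\<phi> q)))) (at (\<phi> q))"
    proof (rule has_derivative_transform_within_open)
      show "open (\<phi> ` (U \<inter> T))" by (rule chart_image_Int_open[OF c(2) chart_open[OF T(2)]])
      show "\<phi> q \<in> \<phi> ` (U \<inter> T)" using T d by blast
    qed (auto simp: chart_inv[OF T(2)] chart_inv[OF c(2)])
    from frechet_derivative_at[OF this, symmetric] show ?thesis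
      by (simp add: directional_def diff_at_def T X_def d \<tau>_def)
  qed
  have X_zero: "X q = 0" if "q \<notin> K" for q
  proof (cases "q \<in> U")
    case True
    then have "\<phi> q \<notin> cball (\<phi> p) r"
      using that chart_inv[OF c(2) True] unfolding K_def by force
    moreover have "linear (frechet_derivative (\<tau> q) (at (\<phi> q)))"
    proof -
      obtain T \<xi> where T: "chart_at A q = (T, \<xi>)" "(T, \<xi>) \<in> A" "q \<in> T"
        by (rule chart_at_obtain)
      show ?thesis
        using smooth_map_on_differentiable[OF smooth_map_on_chart[OF T(2)] chart_open[OF T(2)] c(2) True T(3)]
        by (simp add: \<tau>_def T linear_frechet_derivative)
    qed
    ultimately show ?thesis by (simp add: X_def \<beta>(3) linear_0)
  qed (simp add: X_def)
  have "X \<in> vf A"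
    unfolding vf_def
  proof clarify
    fix V \<psi> assume d: "(V, \<psi>) \<in> A"
    note oV = chart_open[OF d]
    let ?X = "(\<lambda>q. diff_at A \<psi> q (X q)) \<circ> inv_into V \<psi>"
    have o1: "open (\<psi> ` (V \<inter> U))" and o2: "open (\<psi> ` (V \<inter> - K))"
      by (rule chart_image_Int_open[OF d oU], rule chart_image_Int_open[OF d oK])
    have o3: "open (\<phi> ` (U \<inter> V))" by (rule chart_image_Int_open[OF c(2) oV])
    have "smooth_on (\<phi> ` (U \<inter> V)) (\<lambda>x. \<beta> x *\<^sub>R u)"
      by (rule smooth_on_bilinear[OF bounded_bilinear_scaleR o3 smooth_on_subset[OF \<beta>(1)] smooth_on_const]) simp
    then have "smooth_on (\<phi> ` (U \<inter> V)) (\<lambda>x. frechet_derivative (\<psi> \<circ> inv_into U \<phi>) (at x) (\<beta> x *\<^sub>R u))"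
      by (rule smooth_on_derivative_apply[OF o3 transition_smooth[OF c(2) d]])
    then have "smooth_on (\<psi> ` (V \<inter> U)) (\<lambda>y. (\<lambda>x. frechet_derivative (\<psi> \<circ> inv_into U \<phi>) (at x) (\<beta> x *\<^sub>R u))
        ((\<phi> \<circ> inv_into V \<psi>) y))"
      by (rule smooth_on_compose[OF o1 o3 _ _ transition_smooth[OF d c(2)], rotated])
        (auto simp: chart_inv[OF d])
    then have s1: "smooth_on (\<psi> ` (V \<inter> U)) ?X"
      by (rule smooth_on_cong[OF o1])
        (auto simp: chart_inv[OF d] X_chart[OF d, unfolded directional_def])
    have s2: "smooth_on (\<psi> ` (V \<inter> - K)) ?X"
      by (rule smooth_on_cong[OF o2 smooth_on_const[of _ 0]])
        (auto simp: chart_inv[OF d] X_zero linear_0[OF linear_diff_at[OF smooth_map_on_chart[OF d] oV]])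
    have "K \<subseteq> U"
      using r(2) inv_into_into[of _ \<phi> U] unfolding K_def by blast
    then have "\<psi> ` V = \<Union>{\<psi> ` (V \<inter> U), \<psi> ` (V \<inter> - K)}" by auto
    then show "smooth_on (\<psi> ` V) ?X"
      using smooth_on_open_cover[of "{\<psi> ` (V \<inter> U), \<psi> ` (V \<inter> - K)}" ?X] s1 s2 o1 o2 by auto
  qed
  moreover have "X p = u"
  proof -
    have "directional X \<phi> p = X p"
      using diff_at_chart_at[of p] c by (simp add: directional_def)
    moreover have "frechet_derivative (\<phi> \<circ> inv_into U \<phi>) (at (\<phi> p)) u = u"
      using diff_at_chart_at[of p u] c by (simp add: diff_at_def)
    ultimately show ?thesis
      using X_chart[OF c(2,3,3)] \<beta>(2) by simp
  qed
  ultimately show thesis by (rule that)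
qed

lemma smooth_map_const: "smooth_map A (\<lambda>p. c)"
  by (simp add: smooth_map_iff smooth_map_on_const)

lemma smooth_map_diff: "smooth_map A f \<Longrightarrow> smooth_map A h \<Longrightarrow> smooth_map A (\<lambda>p. f p - h p)"
  unfolding smooth_map_iff by (rule smooth_map_on_diff[OF open_UNIV])

lemma smooth_map_minus: "smooth_map A f \<Longrightarrow> smooth_map A (\<lambda>p. - f p)" for f :: "'m \<Rightarrow> real"
  using smooth_map_diff[OF smooth_map_const[of 0]] by simp

lemma smooth_map_vf_apply: "X \<in> vf A \<Longrightarrow> smooth_map A f \<Longrightarrow> smooth_map A (vf_apply A X f)"
  unfolding smooth_map_iff vf_apply_eq by (rule smooth_map_on_directional[OF _ open_UNIV])

lemma vf_apply_add:
  "smooth_map A f \<Longrightarrow> smooth_map A h \<Longrightarrow>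
    vf_apply A X (\<lambda>p. f p + h p) p = vf_apply A X f p + vf_apply A X h p"
  unfolding smooth_map_iff vf_apply_def by (rule diff_at_add[OF open_UNIV]) auto

lemma vf_apply_lie_bracket:
  "X \<in> vf A \<Longrightarrow> Y \<in> vf A \<Longrightarrow> smooth_map A f \<Longrightarrow>
    vf_apply A (lie_bracket A X Y) f p = vf_apply A X (vf_apply A Y f) p - vf_apply A Y (vf_apply A X f) p"
  unfolding smooth_map_iff vf_apply_eq by (rule directional_lie_bracket[OF _ _ open_UNIV]) auto

lemma vf_minus: "X \<in> vf A \<Longrightarrow> (\<lambda>p. - X p) \<in> vf A"
  using vf_scaleR[OF smooth_map_const[of "-1"]] by simp

lemma vf_const_scaleR: "X \<in> vf A \<Longrightarrow> (\<lambda>p. c *\<^sub>R X p) \<in> vf A"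
  by (rule vf_scaleR[OF smooth_map_const])

lemma vf_diff: "X \<in> vf A \<Longrightarrow> Y \<in> vf A \<Longrightarrow> (\<lambda>p. X p - Y p) \<in> vf A"
  using vf_add[OF _ vf_minus] by simp

lemma lie_bracket_skew: "lie_bracket A X Y p = - lie_bracket A Y X p"
  by (simp add: lie_bracket_def Let_def)

lemma lie_bracket_via_chart:
  assumes "X \<in> vf A" "Y \<in> vf A"
  shows "lie_bracket A X Y p = directional X (directional Y (snd (chart_at A p))) p
    - directional Y (directional X (snd (chart_at A p))) p"
proof -
  obtain U \<phi> where c: "chart_at A p = (U, \<phi>)" "(U, \<phi>) \<in> A" "p \<in> U"
    by (rule chart_at_obtain)
  show ?thesis
    using directional_lie_bracket[OF assms chart_open[OF c(2)] smooth_map_on_chart[OF c(2)] c(3)]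
      diff_at_chart_at[of p "lie_bracket A X Y p"]
    by (simp add: directional_def[of "lie_bracket A X Y"] c)
qed

lemma lie_bracket_add_left:
  assumes v: "X \<in> vf A" "Y \<in> vf A" "Z \<in> vf A"
  shows "lie_bracket A (\<lambda>p. X p + Y p) Z p = lie_bracket A X Z p + lie_bracket A Y Z p"
proof -
  obtain U \<phi> where c: "chart_at A p = (U, \<phi>)" "(U, \<phi>) \<in> A" "p \<in> U"
    by (rule chart_at_obtain)
  note o = chart_open[OF c(2)] and s = smooth_map_on_chart[OF c(2)]
  note sm = smooth_map_on_directional[OF _ o]
  have lin: "directional (\<lambda>p. X p + Y p) f q = directional X f q + directional Y f q"
    if "smooth_map_on U f" "q \<in> U" for f :: "'m \<Rightarrow> 'e" and q
    unfolding directional_def by (rule linear_add[OF linear_diff_at[OF that(1) o that(2)]])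
  have "directional Z (directional (\<lambda>p. X p + Y p) \<phi>) p
      = directional Z (\<lambda>q. directional X \<phi> q + directional Y \<phi> q) p"
    unfolding directional_def[of Z]
    by (rule diff_at_cong[OF o sm[OF vf_add[OF v(1,2)] s] lin[OF s] c(3)])
  also have "\<dots> = directional Z (directional X \<phi>) p + directional Z (directional Y \<phi>) p"
    unfolding directional_def[of Z]
    by (rule diff_at_add[OF o sm[OF v(1) s] sm[OF v(2) s] c(3)])
  finally show ?thesis
    using lin[OF sm[OF v(3) s] c(3)]
    by (simp add: lie_bracket_via_chart v vf_add c)
qed

lemma lie_bracket_scaleR_left:
  assumes v: "X \<in> vf A" "Z \<in> vf A" and f: "smooth_map A f"
  shows "lie_bracket A (\<lambda>p. f p *\<^sub>R X p) Z p = f p *\<^sub>R lie_bracket A X Z p - vf_apply A Z f p *\<^sub>R X p"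
proof -
  obtain U \<phi> where c: "chart_at A p = (U, \<phi>)" "(U, \<phi>) \<in> A" "p \<in> U"
    by (rule chart_at_obtain)
  note o = chart_open[OF c(2)] and s = smooth_map_on_chart[OF c(2)]
  note sm = smooth_map_on_directional[OF _ o]
  have fU: "smooth_map_on U f"
    using f unfolding smooth_map_def smooth_map_on_def by (blast intro: smooth_on_subset)
  have lin: "directional (\<lambda>p. f p *\<^sub>R X p) h q = f q *\<^sub>R directional X h q"
    if "smooth_map_on U h" "q \<in> U" for h :: "'m \<Rightarrow> 'e" and q
    unfolding directional_def by (rule linear_scale[OF linear_diff_at[OF that(1) o that(2)]])
  have "directional Z (directional (\<lambda>p. f p *\<^sub>R X p) \<phi>) p
      = directional Z (\<lambda>q. f q *\<^sub>R directional X \<phi> q) p"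
    unfolding directional_def[of Z]
    by (rule diff_at_cong[OF o sm[OF vf_scaleR[OF f v(1)] s] lin[OF s] c(3)])
  also have "\<dots> = f p *\<^sub>R directional Z (directional X \<phi>) p + vf_apply A Z f p *\<^sub>R directional X \<phi> p"
    unfolding directional_def[of Z] vf_apply_def
    by (rule diff_at_bilinear[OF bounded_bilinear_scaleR o fU sm[OF v(1) s] c(3)])
  also have "directional X \<phi> p = X p"
    using diff_at_chart_at[of p "X p"] by (simp add: directional_def c)
  finally show ?thesis
    using lin[OF sm[OF v(2) s] c(3)]
    by (simp add: lie_bracket_via_chart v vf_scaleR f c algebra_simps)
qed

end

section \<open>Curvature of linear connections\<close>

locale affine_connection = smooth_manifold A
  for A :: "('m::{t2_space,second_countable_topology}, 'e::euclidean_space) chart set" +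
  fixes D :: "('m, 'e) connection"
  assumes linear_connection: "linear_connection A D"
begin

lemma connection_vf: "X \<in> vf A \<Longrightarrow> Y \<in> vf A \<Longrightarrow> D X Y \<in> vf A"
  using linear_connection unfolding linear_connection_def by blast

lemma add_left:
  "X \<in> vf A \<Longrightarrow> Y \<in> vf A \<Longrightarrow> Z \<in> vf A \<Longrightarrow> D (\<lambda>p. X p + Y p) Z = (\<lambda>p. D X Z p + D Y Z p)"
  using linear_connection unfolding linear_connection_def by blast

lemma add_right:
  "X \<in> vf A \<Longrightarrow> Y \<in> vf A \<Longrightarrow> Z \<in> vf A \<Longrightarrow> D X (\<lambda>p. Y p + Z p) = (\<lambda>p. D X Y p + D X Z p)"
  using linear_connection unfolding linear_connection_def by blast

lemma scale_left:
  "smooth_map A f \<Longrightarrow> X \<in> vf A \<Longrightarrow> Y \<in> vf A \<Longrightarrow> D (\<lambda>p. f p *\<^sub>R X p) Y = (\<lambda>p. f p *\<^sub>R D X Y p)"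
  using linear_connection unfolding linear_connection_def by blast

lemma scale_right:
  "smooth_map A f \<Longrightarrow> X \<in> vf A \<Longrightarrow> Y \<in> vf A \<Longrightarrow>
    D X (\<lambda>p. f p *\<^sub>R Y p) = (\<lambda>p. vf_apply A X f p *\<^sub>R Y p + f p *\<^sub>R D X Y p)"
  using linear_connection unfolding linear_connection_def by blast

lemma const_scale_right: "X \<in> vf A \<Longrightarrow> Y \<in> vf A \<Longrightarrow> D X (\<lambda>p. c *\<^sub>R Y p) = (\<lambda>p. c *\<^sub>R D X Y p)"
  using scale_right[OF smooth_map_const] by (simp add: vf_apply_def diff_at_const)

lemma minus_left: "X \<in> vf A \<Longrightarrow> Y \<in> vf A \<Longrightarrow> D (\<lambda>p. - X p) Y = (\<lambda>p. - D X Y p)"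
  using scale_left[OF smooth_map_const[of "-1"]] by simp

lemma minus_right: "X \<in> vf A \<Longrightarrow> Y \<in> vf A \<Longrightarrow> D X (\<lambda>p. - Y p) = (\<lambda>p. - D X Y p)"
  using const_scale_right[of X Y "-1"] by simp

lemma diff_left:
  "X \<in> vf A \<Longrightarrow> Y \<in> vf A \<Longrightarrow> Z \<in> vf A \<Longrightarrow> D (\<lambda>p. X p - Y p) Z = (\<lambda>p. D X Z p - D Y Z p)"
  using add_left[OF _ vf_minus] minus_left by simp

lemma diff_right:
  "X \<in> vf A \<Longrightarrow> Y \<in> vf A \<Longrightarrow> Z \<in> vf A \<Longrightarrow> D X (\<lambda>p. Y p - Z p) = (\<lambda>p. D X Y p - D X Z p)"
  using add_right[OF _ _ vf_minus] minus_right by simp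

lemma curvature_vf:
  assumes "X \<in> vf A" "Y \<in> vf A" "Z \<in> vf A"
  shows "curvature A D X Y Z \<in> vf A"
  unfolding curvature_def
  by (intro vf_diff connection_vf vf_lie_bracket assms)

lemma curvature_skew:
  assumes "X \<in> vf A" "Y \<in> vf A" "Z \<in> vf A"
  shows "curvature A D X Y Z p = - curvature A D Y X Z p"
proof -
  have "lie_bracket A X Y = (\<lambda>p. - lie_bracket A Y X p)"
    using lie_bracket_skew by blast
  then show ?thesis
    using fun_cong[OF minus_left[OF vf_lie_bracket[OF assms(2,1)] assms(3)], of p]
    by (simp add: curvature_def)
qed

lemma curvature_add_first:
  assumes "X \<in> vf A" "X' \<in> vf A" "Y \<in> vf A" "Z \<in> vf A"
  shows "curvature A D (\<lambda>p. X p + X' p) Y Z p = curvature A D X Y Z p + curvature A D X' Y Z p"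
proof -
  have b: "lie_bracket A (\<lambda>p. X p + X' p) Y = (\<lambda>p. lie_bracket A X Y p + lie_bracket A X' Y p)"
    using lie_bracket_add_left assms by blast
  show ?thesis
    unfolding curvature_def b
    by (simp add: add_left add_right connection_vf vf_lie_bracket assms)
qed

lemma curvature_scale_first:
  assumes "X \<in> vf A" "Y \<in> vf A" "Z \<in> vf A" "smooth_map A f"
  shows "curvature A D (\<lambda>p. f p *\<^sub>R X p) Y Z p = f p *\<^sub>R curvature A D X Y Z p"
proof -
  have b: "lie_bracket A (\<lambda>p. f p *\<^sub>R X p) Y = (\<lambda>p. f p *\<^sub>R lie_bracket A X Y p - vf_apply A Y f p *\<^sub>R X p)"
    using lie_bracket_scaleR_left assms by blast
  show ?thesis
    unfolding curvature_def b
    by (simp add: diff_left scale_left scale_right connection_vf vf_lie_bracket vf_scaleR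
        smooth_map_vf_apply assms algebra_simps)
qed

lemma curvature_add_third:
  assumes "X \<in> vf A" "Y \<in> vf A" "Z \<in> vf A" "Z' \<in> vf A"
  shows "curvature A D X Y (\<lambda>p. Z p + Z' p) p = curvature A D X Y Z p + curvature A D X Y Z' p"
  unfolding curvature_def
  by (simp add: add_right connection_vf vf_lie_bracket assms)

lemma curvature_scale_third:
  assumes "X \<in> vf A" "Y \<in> vf A" "Z \<in> vf A" "smooth_map A f"
  shows "curvature A D X Y (\<lambda>p. f p *\<^sub>R Z p) p = f p *\<^sub>R curvature A D X Y Z p"
  unfolding curvature_def
  by (simp add: add_right scale_right connection_vf vf_lie_bracket vf_scaleR
      smooth_map_vf_apply vf_apply_lie_bracket assms algebra_simps)

text \<open>The first Bianchi identity for a connection with torsion \<open>T\<close>. Regrouping the second derivatives, \<open>D X (D Y Z -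
D Z Y)\<close> is \<open>D X\<close> applied to torsion plus bracket; what the brackets contribute beyond torsion cancels by the
Jacobi identity.\<close>

lemma cyclic_sum_curvature:
  assumes v: "X \<in> vf A" "Y \<in> vf A" "Z \<in> vf A"
    and T: "\<And>X Y. T X Y = (\<lambda>p. D X Y p - D Y X p - lie_bracket A X Y p)"
  shows "curvature A D X Y Z p + curvature A D Y Z X p + curvature A D Z X Y p
    = D X (T Y Z) p + D Y (T Z X) p + D Z (T X Y) p
      + T X (lie_bracket A Y Z) p + T Y (lie_bracket A Z X) p + T Z (lie_bracket A X Y) p"
proof -
  have *: "D L (T M N) p + T L (lie_bracket A M N) p
      = D L (D M N) p - D L (D N M) p - D (lie_bracket A M N) L p - lie_bracket A L (lie_bracket A M N) p"
    if "L \<in> vf A" "M \<in> vf A" "N \<in> vf A" for L M N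
    unfolding T by (simp add: diff_right connection_vf vf_diff vf_lie_bracket that)
  have "D X (T Y Z) p + D Y (T Z X) p + D Z (T X Y) p
      + T X (lie_bracket A Y Z) p + T Y (lie_bracket A Z X) p + T Z (lie_bracket A X Y) p
    = (D X (T Y Z) p + T X (lie_bracket A Y Z) p) + (D Y (T Z X) p + T Y (lie_bracket A Z X) p)
      + (D Z (T X Y) p + T Z (lie_bracket A X Y) p)"
    by (simp only: ac_simps)
  also have "\<dots> = curvature A D X Y Z p + curvature A D Y Z X p + curvature A D Z X Y p
      - (lie_bracket A X (lie_bracket A Y Z) p + lie_bracket A Y (lie_bracket A Z X) p
         + lie_bracket A Z (lie_bracket A X Y) p)"
    unfolding *[OF v] *[OF v(2,3,1)] *[OF v(3,1,2)] curvature_def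
    by (simp add: algebra_simps)
  finally show ?thesis
    using lie_bracket_Jacobi[OF v, of p] by simp
qed

lemma curvature4_tensor04:
  assumes g: "riemannian_metric A g"
  shows "tensor04 A (curvature4 A g D)"
proof -
  have bil: "bilinear (g p)" for p using g unfolding riemannian_metric_def by blast
  have sm: "smooth_map A (\<lambda>p. g p (X p) (Y p))" if "X \<in> vf A" "Y \<in> vf A" for X Y
    using g that unfolding riemannian_metric_def by blast
  note gl = bilinear_ladd[OF bil] bilinear_lmul[OF bil] bilinear_radd[OF bil] bilinear_rmul[OF bil]
    bilinear_lneg[OF bil] bilinear_lsub[OF bil]
  have second: "curvature A D X Y Z = (\<lambda>p. - curvature A D Y X Z p)"
    if "X \<in> vf A" "Y \<in> vf A" "Z \<in> vf A" for X Y Z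
    using curvature_skew that by blast
  show ?thesis
    unfolding tensor04_def
  proof (intro ballI conjI)
    fix x y z assume v: "x \<in> vf A" "y \<in> vf A" "z \<in> vf A"
    show "fun_linear_form A (\<lambda>v. curvature4 A g D v x y z)"
      unfolding fun_linear_form_def curvature4_def
      by (simp add: sm curvature_vf curvature_add_first curvature_scale_first gl v)
    show "fun_linear_form A (\<lambda>v. curvature4 A g D x v y z)"
      unfolding fun_linear_form_def curvature4_def
      by (simp add: sm smooth_map_minus curvature_vf second[of x] curvature_add_first curvature_scale_first gl v
          vf_minus vf_add vf_scaleR)
    show "fun_linear_form A (\<lambda>v. curvature4 A g D x y v z)"
      unfolding fun_linear_form_def curvature4_def
      by (simp add: sm curvature_vf curvature_add_third curvature_scale_third gl v)
    show "fun_linear_form A (\<lambda>v. curvature4 A g D x y z v)"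
      unfolding fun_linear_form_def curvature4_def
      by (simp add: sm curvature_vf gl v)
  qed
qed

text \<open>Apply the commutator formula for \<open>[X, Y]\<close> to the function \<open>g(Z, W)\<close> and differentiate the metric out.\<close>

lemma metric_connection_curvature_skew:
  assumes g: "riemannian_metric A g"
    and metric: "\<And>X Y Z. X \<in> vf A \<Longrightarrow> Y \<in> vf A \<Longrightarrow> Z \<in> vf A \<Longrightarrow>
      vf_apply A X (ip g Y Z) = (\<lambda>p. ip g (D X Y) Z p + ip g Y (D X Z) p)"
    and v: "X \<in> vf A" "Y \<in> vf A" "Z \<in> vf A" "W \<in> vf A"
  shows "g p (curvature A D X Y Z p) (W p) = - g p (Z p) (curvature A D X Y W p)"
proof -
  have bil: "bilinear (g p)" for p using g unfolding riemannian_metric_def by blast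
  have sm: "smooth_map A (ip g X Y)" if "X \<in> vf A" "Y \<in> vf A" for X Y
    using g that unfolding riemannian_metric_def by blast
  have second: "vf_apply A L (vf_apply A M (ip g Z W)) p
      = g p (D L (D M Z) p) (W p) + g p (D M Z p) (D L W p)
        + (g p (D L Z p) (D M W p) + g p (Z p) (D L (D M W) p))"
    if "L \<in> vf A" "M \<in> vf A" for L M
    by (simp add: metric v that vf_apply_add sm connection_vf)
  show ?thesis
    using second[OF v(1,2)] second[OF v(2,1)] vf_apply_lie_bracket[OF v(1,2) sm[OF v(3,4)], of p]
      fun_cong[OF metric[OF vf_lie_bracket[OF v(1,2)] v(3,4)], of p]
    by (simp add: curvature_def bilinear_lsub[OF bil] bilinear_rsub[OF bil])
qed

lemma parallel_tensor_commutes_curvature: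
  assumes P: "tensor11 A P"
    and parallel: "\<And>X Y. X \<in> vf A \<Longrightarrow> Y \<in> vf A \<Longrightarrow> D X (app P Y) = app P (D X Y)"
    and v: "X \<in> vf A" "Y \<in> vf A" "Z \<in> vf A"
  shows "curvature A D X Y (app P Z) p = P p (curvature A D X Y Z p)"
proof -
  have "linear (P p)" using P unfolding tensor11_def by blast
  then show ?thesis
    by (simp add: curvature_def parallel v connection_vf vf_lie_bracket linear_diff)
qed

end

section \<open>Eigenspaces of an almost product structure\<close>

text \<open>Both eigenspaces of \<open>P\<close> have dimension at least two because the trace vanishes. If the eigenspace for
\<open>e\<close> had no nonzero vector orthogonal to \<open>v\<close>, it would be spanned by \<open>x = v + e P v\<close>; then
\<open>1 + e P\<close>, twice the orthogonal projection onto it, has trace at most \<open>2\<close>, whereas its trace is the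
dimension of the space.\<close>

lemma exists_orthogonal_eigenvector:
  fixes P :: "real^'d \<Rightarrow> real^'d" and g :: "real^'d \<Rightarrow> real^'d \<Rightarrow> real"
  assumes P: "linear P" "\<And>u. P (P u) = u" "trace (matrix P) = 0"
    and g: "bilinear g" "\<And>u v. g u v = g v u" "\<And>u. u \<noteq> 0 \<Longrightarrow> g u u > 0" "\<And>u v. g (P u) (P v) = g u v"
    and dim: "CARD('d) > 2" and e: "e = 1 \<or> e = -1"
  obtains u where "u \<noteq> 0" "P u = e *\<^sub>R u" "g u v = 0"
proof (rule ccontr)
  note found = that
  assume no: "\<not> thesis"
  have ee: "e * e = 1" using e by auto
  define x where "x = v + e *\<^sub>R P v"
  have Px: "P x = e *\<^sub>R x"
    using ee by (simp add: x_def linear_add[OF P(1)] linear_scale[OF P(1)] P(2) scaleR_add_right add.commute)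
  have gP: "g (P u) w = g u (P w)" for u w
    using g(4)[of u "P w"] P(2) by simp
  have gx: "g u x = 2 * g u v" if "P u = e *\<^sub>R u" for u
  proof -
    have "g u (P v) = e * g u v"
      using gP[of u v] that by (simp add: bilinear_lmul[OF g(1)])
    then show ?thesis
      using ee by (simp add: x_def bilinear_radd[OF g(1)] bilinear_rmul[OF g(1)] mult.assoc[symmetric])
  qed
  have none: "u = 0" if "P u = e *\<^sub>R u" "g u x = 0" for u
  proof (rule ccontr)
    assume "u \<noteq> 0"
    moreover have "g u v = 0" using gx[OF that(1)] that(2) by simp
    ultimately show False using found[OF _ that(1)] no by blast
  qed
  \<comment> \<open>If \<open>x = 0\<close>, the quotient is \<open>0\<close> and the formula says that the eigenspace is trivial, which
  \<open>none\<close> gives as well.\<close>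
  have formula: "u + e *\<^sub>R P u = (2 * g u x / g x x) *\<^sub>R x" for u
  proof -
    let ?w = "u + e *\<^sub>R P u"
    have w: "P ?w = e *\<^sub>R ?w"
      using ee by (simp add: linear_add[OF P(1)] linear_scale[OF P(1)] P(2) scaleR_add_right add.commute)
    have wx: "g ?w x = 2 * g u x"
    proof -
      have "g (P u) x = e * g u x"
        using gP[of u x] by (simp add: Px bilinear_rmul[OF g(1)])
      then show ?thesis
        using ee by (simp add: bilinear_ladd[OF g(1)] bilinear_lmul[OF g(1)] mult.assoc[symmetric])
    qed
    have "?w - (g ?w x / g x x) *\<^sub>R x = 0"
    proof (rule none)
      show "P (?w - (g ?w x / g x x) *\<^sub>R x) = e *\<^sub>R (?w - (g ?w x / g x x) *\<^sub>R x)"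
        by (simp only: linear_diff[OF P(1)] linear_scale[OF P(1)] w Px)
          (simp add: scaleR_diff_right)
      show "g (?w - (g ?w x / g x x) *\<^sub>R x) x = 0"
      proof (cases "x = 0")
        case True
        then show ?thesis by (simp add: bilinear_rzero[OF g(1)])
      next
        case False
        then have "g x x \<noteq> 0" using g(3)[of x] by simp
        then show ?thesis by (simp add: bilinear_lsub[OF g(1)] bilinear_lmul[OF g(1)])
      qed
    qed
    then show ?thesis using wx by simp
  qed
  have coord: "(axis i 1 :: real^'d) $ i + e * P (axis i 1) $ i = 2 * g (axis i 1) x / g x x * x $ i" for i
    using arg_cong[OF formula[of "axis i 1"], of "\<lambda>z. z $ i"] by simp
  have tr: "(\<Sum>i\<in>UNIV. P (axis i 1) $ i) = 0"
    using P(3) by (simp add: trace_def matrix_def)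
  have gxx: "(\<Sum>i\<in>UNIV. g (axis i 1) x * x $ i) = g x x"
  proof -
    have "g x x = g (\<Sum>i\<in>UNIV. x $ i *\<^sub>R axis i 1) x"
      by (simp only: basis_expansion flip: scalar_mult_eq_scaleR)
    also have "\<dots> = (\<Sum>i\<in>UNIV. x $ i * g (axis i 1) x)"
    proof -
      have "linear (\<lambda>u. g u x)" using g(1) unfolding bilinear_def by blast
      from linear_sum[OF this, of "\<lambda>i. x $ i *\<^sub>R axis i 1" UNIV] show ?thesis
        by (simp add: linear_scale[OF \<open>linear (\<lambda>u. g u x)\<close>])
    qed
    finally show ?thesis by (simp add: mult.commute)
  qed
  have "real CARD('d) = (\<Sum>i\<in>UNIV. (axis i 1 :: real^'d) $ i + e * P (axis i 1) $ i)"
  proof -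
    have "(\<Sum>i\<in>UNIV. (axis i 1 :: real^'d) $ i) = real CARD('d)"
      by (simp add: axis_def)
    then show ?thesis by (simp add: sum.distrib tr flip: sum_distrib_left)
  qed
  also have "\<dots> = (\<Sum>i\<in>UNIV. 2 / g x x * (g (axis i 1) x * x $ i))"
    by (rule sum.cong) (simp_all only: coord, simp_all)
  also have "\<dots> = 2 / g x x * g x x"
    by (simp only: gxx flip: sum_distrib_left)
  also have "\<dots> \<le> 2" by simp
  finally show False using dim by simp
qed

section \<open>Natural connections on W1-manifolds\<close>

locale w1_manifold =
  fixes A :: "('m::{t2_space,second_countable_topology}, real^'d) chart set"
    and P :: "'m \<Rightarrow> real^'d \<Rightarrow> real^'d"
    and g :: "'m \<Rightarrow> real^'d \<Rightarrow> real^'d \<Rightarrow> real"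
    and nab :: "('m, real^'d) connection"
    and \<Omega> :: "'m \<Rightarrow> real^'d"
    and n :: nat
  assumes n: "n \<ge> 2"
    and W1: "W1_manifold n A P g nab"
    and \<Omega>_vf: "\<Omega> \<in> vf A"
    and \<Omega>_dual: "\<And>x. x \<in> vf A \<Longrightarrow> ip g \<Omega> x = theta A P g nab x"
begin

lemma W1_unfold:
  shows atlas': "smooth_atlas A" and tensor: "tensor11 A P" and metric: "riemannian_metric A g"
    and levi_civita: "levi_civita A g nab" and dim: "CARD('d) = 2 * n"
    and trace: "trace (matrix (P p)) = 0"
    and PP [simp]: "P p (P p u) = u" and g_PP: "g p (P p u) (P p v) = g p u v"
  using W1 unfolding W1_manifold_def riemannian_almost_product_def by auto

sublocale smooth_manifold A
  by standard (rule atlas')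

sublocale LC: affine_connection A nab
  using levi_civita unfolding levi_civita_def by unfold_locales blast

lemma P_linear: "linear (P p)"
  using tensor unfolding tensor11_def by blast

lemmas P_simps = linear_add[OF P_linear] linear_diff[OF P_linear] linear_scale[OF P_linear]
  linear_neg[OF P_linear]

lemma vf_P: "X \<in> vf A \<Longrightarrow> app P X \<in> vf A"
  using tensor unfolding tensor11_def by blast

lemma g_bilinear: "bilinear (g p)" and g_sym: "g p u v = g p v u" and g_pos: "u \<noteq> 0 \<Longrightarrow> g p u u > 0"
  using metric unfolding riemannian_metric_def by blast+

lemmas g_simps = bilinear_ladd[OF g_bilinear] bilinear_radd[OF g_bilinear]
  bilinear_lsub[OF g_bilinear] bilinear_rsub[OF g_bilinear]
  bilinear_lmul[OF g_bilinear] bilinear_rmul[OF g_bilinear]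
  bilinear_lneg[OF g_bilinear] bilinear_rneg[OF g_bilinear]
  bilinear_lzero[OF g_bilinear] bilinear_rzero[OF g_bilinear]

lemma g_P: "g p (P p u) v = g p u (P p v)"
  using g_PP[of p u "P p v"] by simp

lemma g_zero_cancel: "g p u u = 0 \<Longrightarrow> u = 0"
  by (rule ccontr) (drule g_pos[of u p], simp)

lemma smooth_ip: "X \<in> vf A \<Longrightarrow> Y \<in> vf A \<Longrightarrow> smooth_map A (ip g X Y)"
  using metric unfolding riemannian_metric_def by blast

lemma theta_eq: "X \<in> vf A \<Longrightarrow> theta A P g nab X p = g p (\<Omega> p) (X p)"
  using fun_cong[OF \<Omega>_dual] by metis

lemma torsion_free:
  assumes "X \<in> vf A" "Y \<in> vf A"
  shows "lie_bracket A X Y p = nab X Y p - nab Y X p"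
proof -
  have "(\<lambda>p. nab X Y p - nab Y X p) = lie_bracket A X Y"
    using levi_civita assms unfolding levi_civita_def by blast
  from fun_cong[OF this, of p] show ?thesis by simp
qed

lemma nab_metric:
  assumes "X \<in> vf A" "Y \<in> vf A" "Z \<in> vf A"
  shows "vf_apply A X (ip g Y Z) p = g p (nab X Y p) (Z p) + g p (Y p) (nab X Z p)"
proof -
  have "vf_apply A X (ip g Y Z) = (\<lambda>p. ip g (nab X Y) Z p + ip g Y (nab X Z) p)"
    using levi_civita assms unfolding levi_civita_def by blast
  then show ?thesis by simp
qed

text \<open>The defining equation of the class with its last argument removed. Instead of letting that argument range over all vectors, it
suffices to insert the difference of the two sides, which is itself a vector field.\<close>

lemma nab_P:
  assumes v: "X \<in> vf A" "Y \<in> vf A"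
  shows "nab X (app P Y) p = P p (nab X Y p) + (1 / (2 * real n)) *\<^sub>R
    (g p (X p) (Y p) *\<^sub>R \<Omega> p - g p (X p) (P p (Y p)) *\<^sub>R P p (\<Omega> p)
      + g p (\<Omega> p) (Y p) *\<^sub>R X p - g p (\<Omega> p) (P p (Y p)) *\<^sub>R P p (X p))"
    (is "_ = _ + _ *\<^sub>R ?E p")
proof -
  define V where "V = (\<lambda>p. nab X (app P Y) p - P p (nab X Y p) - (1 / (2 * real n)) *\<^sub>R ?E p)"
  note sm = smooth_ip[OF v] smooth_ip[OF v(1) vf_P[OF v(2)]] smooth_ip[OF \<Omega>_vf v(2)]
    smooth_ip[OF \<Omega>_vf vf_P[OF v(2)]]
  have V: "V \<in> vf A"
    unfolding V_def
    by (intro vf_diff vf_const_scaleR vf_add vf_scaleR[OF sm(1)] vf_scaleR[OF sm(2)]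
        vf_scaleR[OF sm(3)] vf_scaleR[OF sm(4)] LC.connection_vf vf_P v \<Omega>_vf)
  have "fundamental_F P g nab X Y V p = 1 / (2 * real n) *
          (ip g X Y p * theta A P g nab V p - ip g X (app P Y) p * theta A P g nab (app P V) p
           + ip g X V p * theta A P g nab Y p - ip g X (app P V) p * theta A P g nab (app P Y) p)"
    using W1 v V unfolding W1_manifold_def Let_def by blast
  also have "\<dots> = g p ((1 / (2 * real n)) *\<^sub>R ?E p) (V p)"
    by (simp add: theta_eq V vf_P v g_simps g_P mult.commute)
  finally have "g p (nab X (app P Y) p - P p (nab X Y p) - (1 / (2 * real n)) *\<^sub>R ?E p) (V p) = 0"
    by (simp only: fundamental_F_def bilinear_lsub[OF g_bilinear])
  then have "V p = 0"
    by (intro g_zero_cancel) (simp only: V_def)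
  then show ?thesis by (simp add: V_def algebra_simps)
qed

text \<open>The vector fields dual to the one-forms \<open>\<alpha> = \<lambda> \<theta>\<circ>P + \<mu> \<theta>\<close> and \<open>\<beta> =
\<lambda> \<theta> + (\<mu> + 1/(2n)) \<theta>\<circ>P\<close> that determine the torsion. The second has the shape of the first
with other parameters.\<close>
definition alpha_field :: "real \<Rightarrow> real \<Rightarrow> 'm \<Rightarrow> real^'d" where
  "alpha_field lam mu = (\<lambda>p. lam *\<^sub>R P p (\<Omega> p) + mu *\<^sub>R \<Omega> p)"

abbreviation beta_field :: "real \<Rightarrow> real \<Rightarrow> 'm \<Rightarrow> real^'d" where
  "beta_field lam mu \<equiv> alpha_field (mu + 1 / (2 * real n)) lam"

abbreviation N :: "real \<Rightarrow> real \<Rightarrow> ('m, real^'d) connection" where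
  "N lam mu \<equiv> natural_connection n A P g nab \<Omega> lam mu"

lemma alpha_field_vf: "alpha_field lam mu \<in> vf A"
  unfolding alpha_field_def by (intro vf_add vf_const_scaleR vf_P \<Omega>_vf)

lemma natural_connection_eq:
  assumes v: "X \<in> vf A" "Y \<in> vf A"
  shows "N lam mu X Y = (\<lambda>p. nab X Y p + g p (X p) (P p (Y p)) *\<^sub>R alpha_field lam mu p
    - g p (alpha_field lam mu p) (Y p) *\<^sub>R P p (X p) + g p (X p) (Y p) *\<^sub>R beta_field lam mu p
    - g p (beta_field lam mu p) (Y p) *\<^sub>R X p)"
  unfolding natural_connection_def Let_def alpha_field_def theta_eq[OF vf_P[OF v(2)]] theta_eq[OF v(2)]
  by (simp add: g_simps g_P add.commute)

lemma natural_linear_connection: "linear_connection A (N lam mu)"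
proof -
  let ?a = "alpha_field lam mu" and ?b = "beta_field lam mu"
  have N_vf: "N lam mu X Y \<in> vf A" if v: "X \<in> vf A" "Y \<in> vf A" for X Y
    unfolding natural_connection_eq[OF v]
    by (intro vf_diff vf_add vf_scaleR[OF smooth_ip[OF v]] vf_scaleR[OF smooth_ip[OF v(1) vf_P[OF v(2)]]]
        vf_scaleR[OF smooth_ip[OF alpha_field_vf v(2)]] LC.connection_vf vf_P v alpha_field_vf)
  show ?thesis
    unfolding linear_connection_def
  proof (intro conjI ballI allI impI)
    fix X Y Z assume v: "X \<in> vf A" "Y \<in> vf A" "Z \<in> vf A"
    show "N lam mu (\<lambda>p. X p + Y p) Z = (\<lambda>p. N lam mu X Z p + N lam mu Y Z p)"
      unfolding natural_connection_eq[OF vf_add[OF v(1,2)] v(3)] natural_connection_eq[OF v(1,3)]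
        natural_connection_eq[OF v(2,3)] LC.add_left[OF v]
      by (rule ext) (simp add: g_simps P_simps algebra_simps)
    show "N lam mu X (\<lambda>p. Y p + Z p) = (\<lambda>p. N lam mu X Y p + N lam mu X Z p)"
      unfolding natural_connection_eq[OF v(1) vf_add[OF v(2,3)]] natural_connection_eq[OF v(1,3)]
        natural_connection_eq[OF v(1,2)] LC.add_right[OF v]
      by (rule ext) (simp add: g_simps P_simps algebra_simps)
  next
    fix f :: "'m \<Rightarrow> real" and X Y assume f: "smooth_map A f" and v: "X \<in> vf A" "Y \<in> vf A"
    show "N lam mu (\<lambda>p. f p *\<^sub>R X p) Y = (\<lambda>p. f p *\<^sub>R N lam mu X Y p)"
      unfolding natural_connection_eq[OF vf_scaleR[OF f v(1)] v(2)] natural_connection_eq[OF v]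
        LC.scale_left[OF f v]
      by (rule ext) (simp add: g_simps P_simps algebra_simps)
    show "N lam mu X (\<lambda>p. f p *\<^sub>R Y p) = (\<lambda>p. vf_apply A X f p *\<^sub>R Y p + f p *\<^sub>R N lam mu X Y p)"
      unfolding natural_connection_eq[OF v(1) vf_scaleR[OF f v(2)]] natural_connection_eq[OF v]
        LC.scale_right[OF f v]
      by (rule ext) (simp add: g_simps P_simps algebra_simps)
  qed (rule N_vf)
qed

sublocale N: affine_connection A "N lam mu" for lam mu
  by unfold_locales (rule natural_linear_connection)

text \<open>Up to the terms from \<open>nab_P\<close> the added tensor would commute with \<open>P\<close> if \<open>P\<close> exchanged the
\<open>\<alpha>\<close>- and \<open>\<beta>\<close>-fields. It does so except for the summand \<open>1/(2n)\<close>, which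
compensates exactly the derivative of \<open>P\<close>.\<close>

lemma natural_parallel_P:
  assumes v: "X \<in> vf A" "Y \<in> vf A"
  shows "N lam mu X (app P Y) = app P (N lam mu X Y)"
  unfolding natural_connection_eq[OF v(1) vf_P[OF v(2)]] natural_connection_eq[OF v] alpha_field_def
  by (rule ext) (simp add: nab_P[OF v] g_simps P_simps g_P algebra_simps)

lemma natural_metric:
  assumes v: "X \<in> vf A" "Y \<in> vf A" "Z \<in> vf A"
  shows "vf_apply A X (ip g Y Z) = (\<lambda>p. ip g (N lam mu X Y) Z p + ip g Y (N lam mu X Z) p)"
proof
  fix p
  have 1: "g p (P p (X p)) (Z p) = g p (X p) (P p (Z p))" "g p (P p (X p)) (Y p) = g p (X p) (P p (Y p))"
    by (simp_all add: g_P)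
  show "vf_apply A X (ip g Y Z) p = ip g (N lam mu X Y) Z p + ip g Y (N lam mu X Z) p"
    unfolding natural_connection_eq[OF v(1,2)] natural_connection_eq[OF v(1,3)] nab_metric[OF v]
    by (simp add: g_simps g_sym[of p "Y p" "alpha_field _ _ p"] g_sym[of p "Y p" "P p (X p)"]
        g_sym[of p "Y p" "X p"] 1 algebra_simps)
qed

lemma natural_torsion:
  assumes v: "X \<in> vf A" "Y \<in> vf A"
  shows "N lam mu X Y p - N lam mu Y X p - lie_bracket A X Y p =
    g p (alpha_field lam mu p) (X p) *\<^sub>R P p (Y p) - g p (alpha_field lam mu p) (Y p) *\<^sub>R P p (X p)
    + g p (beta_field lam mu p) (X p) *\<^sub>R Y p - g p (beta_field lam mu p) (Y p) *\<^sub>R X p"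
  using g_sym[of p "X p" "Y p"] g_P[of p "X p" "Y p"] g_sym[of p "P p (X p)" "Y p"]
  by (simp add: natural_connection_eq v torsion_free)

text \<open>The exterior derivative of the one-form \<open>g(V, \<cdot>)\<close>, written with the torsion-free metric connection so that it
is visibly linear in \<open>V\<close> over the reals.\<close>
definition ext_deriv :: "('m \<Rightarrow> real^'d) \<Rightarrow> ('m \<Rightarrow> real^'d) \<Rightarrow> ('m \<Rightarrow> real^'d) \<Rightarrow> 'm \<Rightarrow> real" where
  "ext_deriv V X Y p = g p (nab X V p) (Y p) - g p (nab Y V p) (X p)"

lemma ext_deriv_eq:
  assumes v: "V \<in> vf A" "X \<in> vf A" "Y \<in> vf A"
  shows "ext_deriv V X Y p = vf_apply A X (ip g V Y) p - vf_apply A Y (ip g V X) p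
    - g p (V p) (lie_bracket A X Y p)"
  by (simp add: ext_deriv_def nab_metric v torsion_free g_simps)

lemma ext_deriv_skew: "ext_deriv V Y X p = - ext_deriv V X Y p"
  by (simp add: ext_deriv_def)

lemma ext_deriv_add:
  assumes "X \<in> vf A" "X' \<in> vf A" "Y \<in> vf A" "V \<in> vf A"
  shows "ext_deriv V (\<lambda>p. X p + X' p) Y p = ext_deriv V X Y p + ext_deriv V X' Y p"
  by (simp add: ext_deriv_def LC.add_left assms g_simps)

lemma ext_deriv_alpha_field:
  assumes "X \<in> vf A" "Y \<in> vf A"
  shows "ext_deriv (alpha_field lam mu) X Y p = lam * ext_deriv (app P \<Omega>) X Y p + mu * ext_deriv \<Omega> X Y p"
  by (simp add: ext_deriv_def alpha_field_def LC.add_right LC.const_scale_right vf_const_scaleR vf_P \<Omega>_vf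
      assms g_simps algebra_simps)

lemma nabla_form_theta:
  "X \<in> vf A \<Longrightarrow> Y \<in> vf A \<Longrightarrow> nabla_form A nab (theta A P g nab) X Y p = g p (nab X \<Omega> p) (Y p)"
  using nab_metric[OF _ \<Omega>_vf, of X Y p]
  by (simp add: nabla_form_def theta_eq LC.connection_vf flip: \<Omega>_dual)

lemma ext_deriv_\<Omega>:
  assumes "X \<in> vf A" "Y \<in> vf A"
  shows "ext_deriv \<Omega> X Y p = nabla_form A nab (theta A P g nab) X Y p - nabla_form A nab (theta A P g nab) Y X p"
  by (simp add: ext_deriv_def nabla_form_theta assms)

text \<open>The term with the derivative of \<open>P\<close> is \<open>F(X, \<Omega>, Y)\<close>, which is symmetric in \<open>X\<close> and
\<open>Y\<close> on a W1-manifold and drops out.\<close>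

lemma ext_deriv_P\<Omega>:
  assumes "X \<in> vf A" "Y \<in> vf A"
  shows "ext_deriv (app P \<Omega>) X Y p = nabla_form A nab (theta A P g nab) X (app P Y) p
    - nabla_form A nab (theta A P g nab) Y (app P X) p"
  using g_sym[of p "X p" "Y p"] g_P[of p "X p" "Y p"] g_sym[of p "P p (X p)" "Y p"]
    g_sym[of p "X p" "\<Omega> p"] g_sym[of p "Y p" "\<Omega> p"] g_P[of p "X p" "\<Omega> p"] g_P[of p "Y p" "\<Omega> p"]
    g_sym[of p "P p (X p)" "\<Omega> p"] g_sym[of p "P p (Y p)" "\<Omega> p"]
  by (simp add: ext_deriv_def nabla_form_theta assms vf_P nab_P \<Omega>_vf g_simps g_P algebra_simps)

text \<open>Differentiating the torsion in \<open>cyclic_sum_curvature\<close> produces the exterior derivatives of \<open>\<alpha>\<close>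
and \<open>\<beta>\<close> together with terms \<open>\<alpha>(X) P T(Y,Z) + \<beta>(X) T(Y,Z)\<close>, since \<open>P\<close> is
parallel. Their cyclic sum is zero: the coefficient of each vector is a symmetric product of \<open>\<alpha>\<close> and
\<open>\<beta>\<close> that occurs twice with opposite signs.\<close>

lemma natural_cyclic_sum:
  fixes lam mu :: real
  assumes v: "X \<in> vf A" "Y \<in> vf A" "Z \<in> vf A"
  defines "a \<equiv> alpha_field lam mu" and "b \<equiv> beta_field lam mu" and "R \<equiv> curvature A (N lam mu)"
  shows "R X Y Z p + R Y Z X p + R Z X Y p =
      ext_deriv b X Y p *\<^sub>R Z p + ext_deriv a X Y p *\<^sub>R P p (Z p)
    + ext_deriv b Y Z p *\<^sub>R X p + ext_deriv a Y Z p *\<^sub>R P p (X p)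
    + ext_deriv b Z X p *\<^sub>R Y p + ext_deriv a Z X p *\<^sub>R P p (Y p)"
proof -
  define D where "D = N lam mu"
  define T where "T X Y = (\<lambda>p. D X Y p - D Y X p - lie_bracket A X Y p)" for X Y
  have ab: "a \<in> vf A" "b \<in> vf A" by (simp_all add: a_def b_def alpha_field_vf)
  have T_eq: "T L M = (\<lambda>p. g p (a p) (L p) *\<^sub>R P p (M p) - g p (a p) (M p) *\<^sub>R P p (L p)
      + g p (b p) (L p) *\<^sub>R M p - g p (b p) (M p) *\<^sub>R L p)" if "L \<in> vf A" "M \<in> vf A" for L M
    unfolding T_def D_def a_def b_def by (rule ext) (rule natural_torsion[OF that])
  have bracket: "lie_bracket A L M p = D L M p - D M L p
      - (g p (a p) (L p) *\<^sub>R P p (M p) - g p (a p) (M p) *\<^sub>R P p (L p)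
      + g p (b p) (L p) *\<^sub>R M p - g p (b p) (M p) *\<^sub>R L p)" if "L \<in> vf A" "M \<in> vf A" for L M
    using fun_cong[OF T_eq[OF that], of p] by (simp add: T_def algebra_simps)
  have DT: "D L (T M K) p =
      vf_apply A L (ip g a M) p *\<^sub>R P p (K p) + g p (a p) (M p) *\<^sub>R P p (D L K p)
    - (vf_apply A L (ip g a K) p *\<^sub>R P p (M p) + g p (a p) (K p) *\<^sub>R P p (D L M p))
    + (vf_apply A L (ip g b M) p *\<^sub>R K p + g p (b p) (M p) *\<^sub>R D L K p)
    - (vf_apply A L (ip g b K) p *\<^sub>R M p + g p (b p) (K p) *\<^sub>R D L M p)"
    if w: "L \<in> vf A" "M \<in> vf A" "K \<in> vf A" for L M K
    unfolding T_eq[OF w(2,3)] D_def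
    by (simp add: N.add_right N.diff_right N.scale_right smooth_ip ab w vf_P vf_scaleR vf_diff vf_add
        natural_parallel_P)
  have TB: "T L (lie_bracket A M K) p = g p (a p) (L p) *\<^sub>R P p (lie_bracket A M K p)
      - g p (a p) (lie_bracket A M K p) *\<^sub>R P p (L p)
      + g p (b p) (L p) *\<^sub>R lie_bracket A M K p - g p (b p) (lie_bracket A M K p) *\<^sub>R L p"
    if "L \<in> vf A" "M \<in> vf A" "K \<in> vf A" for L M K
    using T_eq[OF that(1) vf_lie_bracket[OF that(2,3)]] by simp
  have P_bracket: "P p (lie_bracket A L M p) = P p (D L M p) - P p (D M L p)
      - (g p (a p) (L p) *\<^sub>R M p - g p (a p) (M p) *\<^sub>R L p
      + g p (b p) (L p) *\<^sub>R P p (M p) - g p (b p) (M p) *\<^sub>R P p (L p))" if "L \<in> vf A" "M \<in> vf A" for L M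
    unfolding bracket[OF that] by (simp add: P_simps)
  have "R X Y Z p + R Y Z X p + R Z X Y p
    = D X (T Y Z) p + D Y (T Z X) p + D Z (T X Y) p
      + T X (lie_bracket A Y Z) p + T Y (lie_bracket A Z X) p + T Z (lie_bracket A X Y) p"
    unfolding R_def D_def by (rule N.cyclic_sum_curvature[OF v]) (simp add: T_def D_def)
  also have "\<dots> = ext_deriv b X Y p *\<^sub>R Z p + ext_deriv a X Y p *\<^sub>R P p (Z p)
    + ext_deriv b Y Z p *\<^sub>R X p + ext_deriv a Y Z p *\<^sub>R P p (X p)
    + ext_deriv b Z X p *\<^sub>R Y p + ext_deriv a Z X p *\<^sub>R P p (Y p)"
    unfolding DT[OF v] DT[OF v(2,3,1)] DT[OF v(3,1,2)] TB[OF v] TB[OF v(2,3,1)] TB[OF v(3,1,2)]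
      ext_deriv_eq[OF ab(1) v(1,2)] ext_deriv_eq[OF ab(1) v(2,3)] ext_deriv_eq[OF ab(1) v(3,1)]
      ext_deriv_eq[OF ab(2) v(1,2)] ext_deriv_eq[OF ab(2) v(2,3)] ext_deriv_eq[OF ab(2) v(3,1)]
    \<comment> \<open>Brackets under \<open>P\<close> are expanded first: after expanding the plain ones, \<open>P_bracket\<close> would no longer
    match.\<close>
    by (simp only: P_bracket v, simp only: bracket v, simp add: algebra_simps)
  finally show ?thesis .
qed

lemma natural_curvature_skew:
  assumes "X \<in> vf A" "Y \<in> vf A" "Z \<in> vf A" "W \<in> vf A"
  shows "g p (curvature A (N lam mu) X Y Z p) (W p) = - g p (Z p) (curvature A (N lam mu) X Y W p)"
  by (rule N.metric_connection_curvature_skew[OF metric _ assms]) (rule natural_metric)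

lemma natural_curvature_P:
  assumes "X \<in> vf A" "Y \<in> vf A" "Z \<in> vf A"
  shows "curvature A (N lam mu) X Y (app P Z) p = P p (curvature A (N lam mu) X Y Z p)"
  by (rule N.parallel_tensor_commutes_curvature[OF tensor _ assms]) (rule natural_parallel_P)

section \<open>The Bianchi identity and closed one-forms\<close>

definition eigenfield :: "real \<Rightarrow> ('m \<Rightarrow> real^'d) \<Rightarrow> bool" where
  "eigenfield e X \<longleftrightarrow> X \<in> vf A \<and> (\<forall>p. P p (X p) = e *\<^sub>R X p)"

lemma eigenfield_vf: "eigenfield e X \<Longrightarrow> X \<in> vf A"
  and eigenfield_P: "eigenfield e X \<Longrightarrow> P p (X p) = e *\<^sub>R X p"
  by (simp_all add: eigenfield_def)

lemma eigenfield_projection: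
  assumes "X \<in> vf A" and e: "e = 1 \<or> e = -1"
  shows "eigenfield e (\<lambda>p. (1 / 2) *\<^sub>R (X p + e *\<^sub>R P p (X p)))"
  unfolding eigenfield_def
proof (intro conjI allI)
  show "(\<lambda>p. (1 / 2) *\<^sub>R (X p + e *\<^sub>R P p (X p))) \<in> vf A"
    by (intro vf_const_scaleR vf_add vf_P assms(1))
  show "P p ((1 / 2) *\<^sub>R (X p + e *\<^sub>R P p (X p))) = e *\<^sub>R (1 / 2) *\<^sub>R (X p + e *\<^sub>R P p (X p))" for p
    using e by (auto simp: P_simps algebra_simps)
qed

lemma eigenfields_orthogonal:
  assumes "eigenfield e X" "eigenfield (- e) Z" and e: "e = 1 \<or> e = -1"
  shows "g p (X p) (Z p) = 0"
  using g_PP[of p "X p" "Z p"] e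
  by (auto simp: eigenfield_P[OF assms(1)] eigenfield_P[OF assms(2)] g_simps)

lemma exists_orthogonal_eigenfield:
  assumes e: "e = 1 \<or> e = -1"
  obtains X where "eigenfield e X" "X p \<noteq> 0" "g p (X p) v = 0"
proof -
  have "CARD('d) > 2" using dim n by simp
  from exists_orthogonal_eigenvector[where P = "P p" and g = "g p" and v = v,
      OF P_linear PP trace g_bilinear g_sym g_pos g_PP this e]
  obtain u where u: "u \<noteq> 0" "P p u = e *\<^sub>R u" "g p u v = 0" .
  obtain X where X: "X \<in> vf A" "X p = u"
    by (rule vf_extension)
  have half: "(1 / 2) *\<^sub>R (X p + e *\<^sub>R P p (X p)) = u"
    using e X u by (auto simp flip: scaleR_add_left)
  show thesis
    by (rule that[OF eigenfield_projection[OF X(1) e]]) (simp_all only: half u not_False_eq_True)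
qed

text \<open>This holds on every W1-manifold, whatever the curvature of a particular natural connection. Take \<open>Z\<close> in the opposite
eigenbundle and the \<open>Z\<close>-component of the cyclic sum: \<open>R\<close> is skew in its last two arguments, and
\<open>R(Y,Z)X\<close>, \<open>R(Z,X)Y\<close> stay in the eigenbundle of \<open>X, Y\<close>, so the component vanishes and
\<open>d\<beta> - e d\<alpha>\<close> is zero on \<open>(X, Y)\<close>. The two one-forms are then separated by varying the
parameters.\<close>

lemma same_sign_closed:
  assumes X: "eigenfield e X" and Y: "eigenfield e Y" and e: "e = 1 \<or> e = -1"
  shows "ext_deriv \<Omega> X Y p = 0" and "ext_deriv (app P \<Omega>) X Y p = 0"
proof -
  have ne: "- e = 1 \<or> - e = -1" using e by auto
  obtain Z where Z: "eigenfield (- e) Z" "Z p \<noteq> 0"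
    using exists_orthogonal_eigenfield[OF ne] by metis
  note v = eigenfield_vf[OF X] eigenfield_vf[OF Y] eigenfield_vf[OF Z(1)]
  have pos: "g p (Z p) (Z p) \<noteq> 0" using g_pos[OF Z(2), of p] by simp
  have gXZ: "g p (X p) (Z p) = 0" "g p (Y p) (Z p) = 0"
    by (rule eigenfields_orthogonal[OF X Z(1) e], rule eigenfields_orthogonal[OF Y Z(1) e])
  have main: "ext_deriv (beta_field lam mu) X Y p - e * ext_deriv (alpha_field lam mu) X Y p = 0" for lam mu
  proof -
    let ?R = "curvature A (N lam mu)"
    have RZ: "g p (?R X Y Z p) (Z p) = 0"
      using natural_curvature_skew[OF v v(3), of p lam mu]
        g_sym[of p "?R X Y Z p" "Z p"] by simp
    have R0: "g p (?R L Z K p) (Z p) = 0" "g p (?R Z L K p) (Z p) = 0"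
      if L: "L \<in> vf A" and K: "eigenfield e K" for L K
    proof -
      have "g p (?R L Z K p) (Z p) = g p (?R L Z (app P K) p) (P p (Z p))"
        using natural_curvature_P[OF L v(3) eigenfield_vf[OF K], of lam mu p]
        by (simp add: g_PP)
      also have "app P K = (\<lambda>p. e *\<^sub>R K p)" using eigenfield_P[OF K] by blast
      also have "?R L Z (\<lambda>p. e *\<^sub>R K p) p = e *\<^sub>R ?R L Z K p"
        by (rule N.curvature_scale_third[OF L v(3) eigenfield_vf[OF K] smooth_map_const])
      also have "P p (Z p) = (- e) *\<^sub>R Z p" by (rule eigenfield_P[OF Z(1)])
      also have "g p (e *\<^sub>R ?R L Z K p) ((- e) *\<^sub>R Z p) = - (e * e) * g p (?R L Z K p) (Z p)"
        by (simp add: g_simps)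
      also have "e * e = 1" using e by auto
      finally show 0: "g p (?R L Z K p) (Z p) = 0" by linarith
      show "g p (?R Z L K p) (Z p) = 0"
        using 0 N.curvature_skew[OF v(3) L eigenfield_vf[OF K], of lam mu p] by (simp add: g_simps)
    qed
    have "g p (?R X Y Z p + ?R Y Z X p + ?R Z X Y p) (Z p)
        = (ext_deriv (beta_field lam mu) X Y p - e * ext_deriv (alpha_field lam mu) X Y p) * g p (Z p) (Z p)"
      unfolding natural_cyclic_sum[OF v]
      by (simp add: g_simps gXZ eigenfield_P[OF X] eigenfield_P[OF Y] eigenfield_P[OF Z(1)] algebra_simps)
    then show ?thesis
      using pos by (simp add: g_simps RZ R0 X Y v)
  qed
  \<comment> \<open>For \<open>\<lambda> = \<mu> = 0\<close> the equation reads \<open>d(\<theta>\<circ>P)(X,Y) / (2n) = 0\<close>; for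
  \<open>\<lambda> = 1\<close>, \<open>\<mu> = 0\<close> it then reads \<open>d\<theta>(X,Y) = 0\<close>.\<close>
  from main[of 0 0] n show P\<Omega>: "ext_deriv (app P \<Omega>) X Y p = 0"
    by (simp add: ext_deriv_alpha_field v)
  from main[of 0 1] show "ext_deriv \<Omega> X Y p = 0"
    by (simp add: ext_deriv_alpha_field v P\<Omega>)
qed

text \<open>Rank at least two of the eigenbundles provides \<open>Y\<close> orthogonal to \<open>X\<close> in the same eigenbundle. In the
\<open>Y\<close>-component of the cyclic sum the terms along \<open>Z\<close> and \<open>X\<close> then disappear and only the
coefficient of \<open>Y\<close> is left.\<close>

lemma mixed_sign_Bianchi:
  assumes Bianchi: "\<And>X Y Z p. X \<in> vf A \<Longrightarrow> Y \<in> vf A \<Longrightarrow> Z \<in> vf A \<Longrightarrow>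
      curvature A (N lam mu) X Y Z p + curvature A (N lam mu) Y Z X p + curvature A (N lam mu) Z X Y p = 0"
    and X: "eigenfield e X" and Z: "eigenfield (- e) Z" and e: "e = 1 \<or> e = -1"
  shows "ext_deriv (beta_field lam mu) Z X p + e * ext_deriv (alpha_field lam mu) Z X p = 0"
proof -
  obtain Y where Y: "eigenfield e Y" "Y p \<noteq> 0" "g p (Y p) (X p) = 0"
    by (rule exists_orthogonal_eigenfield[OF e])
  note v = eigenfield_vf[OF X] eigenfield_vf[OF Y(1)] eigenfield_vf[OF Z]
  have "0 = g p (curvature A (N lam mu) X Y Z p + curvature A (N lam mu) Y Z X p + curvature A (N lam mu) Z X Y p) (Y p)"
    unfolding Bianchi[OF v] by (simp add: g_simps)
  also have "\<dots> = (ext_deriv (beta_field lam mu) Z X p + e * ext_deriv (alpha_field lam mu) Z X p) * g p (Y p) (Y p)"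
    unfolding natural_cyclic_sum[OF v]
    using eigenfields_orthogonal[OF Y(1) Z e, of p] Y(3)
    by (simp add: g_simps g_sym[of p "Z p"] g_sym[of p "X p"] eigenfield_P[OF X] eigenfield_P[OF Y(1)] eigenfield_P[OF Z] algebra_simps)
  finally show ?thesis using g_pos[OF Y(2), of p] by simp
qed

text \<open>Decompose both arguments into eigenfields: pairs of equal sign are covered by \<open>same_sign_closed\<close>, and on mixed pairs
\<open>mixed_sign_Bianchi\<close>, used for both signs, gives \<open>d\<beta> + d\<alpha> = 0 = d\<beta> - d\<alpha>\<close>.\<close>

lemma Bianchi_imp_closed:
  assumes Bianchi: "\<And>X Y Z p. X \<in> vf A \<Longrightarrow> Y \<in> vf A \<Longrightarrow> Z \<in> vf A \<Longrightarrow>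
      curvature A (N lam mu) X Y Z p + curvature A (N lam mu) Y Z X p + curvature A (N lam mu) Z X Y p = 0"
    and v: "X \<in> vf A" "Y \<in> vf A"
  shows "ext_deriv (alpha_field lam mu) X Y p = 0 \<and> ext_deriv (beta_field lam mu) X Y p = 0"
proof -
  have same: "ext_deriv (alpha_field c d) L M p = 0" if "eigenfield e L" "eigenfield e M" "e = 1 \<or> e = -1"
    for c d e L M
    using same_sign_closed[OF that] by (simp add: ext_deriv_alpha_field eigenfield_vf[OF that(1)] eigenfield_vf[OF that(2)])
  have mixed: "ext_deriv (alpha_field lam mu) L M p = 0 \<and> ext_deriv (beta_field lam mu) L M p = 0"
    if L: "eigenfield 1 L" and M: "eigenfield (-1) M" for L M
    using mixed_sign_Bianchi[OF Bianchi L M, of p] mixed_sign_Bianchi[OF Bianchi M, of L p] L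
      ext_deriv_skew[of "alpha_field lam mu" L M p] ext_deriv_skew[of "beta_field lam mu" L M p]
    by simp
  define pr where "pr e W = (\<lambda>p. (1 / 2) *\<^sub>R (W p + e *\<^sub>R P p (W p)))" for e W
  have pr: "eigenfield 1 (pr 1 W)" "eigenfield (-1) (pr (-1) W)" if "W \<in> vf A" for W
    unfolding pr_def using eigenfield_projection[OF that] by blast+
  have pr_vf: "pr 1 W \<in> vf A" "pr (-1) W \<in> vf A" if "W \<in> vf A" for W
    using pr[OF that] eigenfield_vf by blast+
  have split: "W = (\<lambda>p. pr 1 W p + pr (-1) W p)" for W
    by (rule ext) (simp add: pr_def flip: scaleR_add_left scaleR_add_right)
  have "ext_deriv V X Y p = ext_deriv V (pr 1 X) (pr 1 Y) p + ext_deriv V (pr 1 X) (pr (-1) Y) p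
      + (- ext_deriv V (pr 1 Y) (pr (-1) X) p + ext_deriv V (pr (-1) X) (pr (-1) Y) p)"
    if "V \<in> vf A" for V
  proof -
    have left: "ext_deriv V W Y' p = ext_deriv V (pr 1 W) Y' p + ext_deriv V (pr (-1) W) Y' p"
      if "W \<in> vf A" "Y' \<in> vf A" for W Y'
      by (subst split[of W]) (rule ext_deriv_add[OF pr_vf[OF that(1)] that(2) \<open>V \<in> vf A\<close>])
    show ?thesis
      unfolding left[OF v] ext_deriv_skew[of V "pr _ X" Y] left[OF v(2) pr_vf(1)[OF v(1)]]
        left[OF v(2) pr_vf(2)[OF v(1)]]
      using ext_deriv_skew[of V "pr 1 X"] ext_deriv_skew[of V "pr (-1) X" "pr (-1) Y"] by simp
  qed
  then show ?thesis
    using mixed[OF pr(1)[OF v(1)] pr(2)[OF v(2)]] mixed[OF pr(1)[OF v(2)] pr(2)[OF v(1)]]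
      same[OF pr(1)[OF v(1)] pr(1)[OF v(2)]] same[OF pr(2)[OF v(1)] pr(2)[OF v(2)]] alpha_field_vf
    by simp
qed

lemma natural_curvature_P_tensor_iff:
  "riemannian_P_tensor A P (curvature4 A g (N lam mu)) \<longleftrightarrow>
    (\<forall>X\<in>vf A. \<forall>Y\<in>vf A. \<forall>p. ext_deriv (beta_field lam mu) X Y p = 0 \<and> ext_deriv (alpha_field lam mu) X Y p = 0)"
    (is "?L \<longleftrightarrow> ?R")
proof
  let ?K = "curvature A (N lam mu)"
  assume L: ?L
  have "?K X Y Z p + ?K Y Z X p + ?K Z X Y p = 0" if v: "X \<in> vf A" "Y \<in> vf A" "Z \<in> vf A" for X Y Z p
  proof -
    obtain W where W: "W \<in> vf A" "W p = ?K X Y Z p + ?K Y Z X p + ?K Z X Y p"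
      by (rule vf_extension)
    have "g p (?K X Y Z p) (W p) + g p (?K Y Z X p) (W p) + g p (?K Z X Y p) (W p) = 0"
      using L v W(1) unfolding riemannian_P_tensor_def curvature4_def by blast
    then have "g p (W p) (W p) = 0"
      by (subst (1) W(2)) (simp only: g_simps)
    then show ?thesis using g_zero_cancel W(2) by metis
  qed
  then show ?R using Bianchi_imp_closed by blast
next
  let ?K = "curvature A (N lam mu)"
  assume R: ?R
  show ?L
    unfolding riemannian_P_tensor_def
  proof (intro conjI ballI allI)
    show "tensor04 A (curvature4 A g (N lam mu))"
      by (rule N.curvature4_tensor04[OF metric])
    fix x y z w p assume v: "x \<in> vf A" "y \<in> vf A" "z \<in> vf A" "w \<in> vf A"
    show "curvature4 A g (N lam mu) x y z w p = - curvature4 A g (N lam mu) y x z w p"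
      using N.curvature_skew[OF v(1-3), of lam mu p] by (simp add: curvature4_def g_simps)
    show "curvature4 A g (N lam mu) x y z w p = - curvature4 A g (N lam mu) x y w z p"
      using natural_curvature_skew[OF v, of p lam mu] g_sym
      by (simp add: curvature4_def)
    have "?K x y z p + ?K y z x p + ?K z x y p = 0"
      unfolding natural_cyclic_sum[OF v(1-3)] using R v by simp
    then have "g p (?K x y z p + ?K y z x p + ?K z x y p) (w p) = 0"
      by (simp only: g_simps)
    then show "curvature4 A g (N lam mu) x y z w p + curvature4 A g (N lam mu) y z x w p
        + curvature4 A g (N lam mu) z x y w p = 0"
      by (simp only: curvature4_def g_simps)
    show "curvature4 A g (N lam mu) x y (app P z) (app P w) p = curvature4 A g (N lam mu) x y z w p"
      using natural_curvature_P[OF v(1-3), of lam mu p]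
      by (simp add: curvature4_def g_PP)
  qed
qed

end

theorem proposition4p2:
  fixes A :: "('m::{t2_space,second_countable_topology}, real^'d) chart set"
    and P :: "'m \<Rightarrow> real^'d \<Rightarrow> real^'d"
    and g :: "'m \<Rightarrow> real^'d \<Rightarrow> real^'d \<Rightarrow> real"
    and nab :: "('m, real^'d) connection"
    and \<theta> :: "('m \<Rightarrow> real^'d) \<Rightarrow> 'm \<Rightarrow> real"
    and \<Omega> :: "'m \<Rightarrow> real^'d"
    and n :: nat
    and lam mu :: real
  assumes "n \<ge> 2"
    and "W1_manifold n A P g nab"
    and "\<theta> = theta A P g nab"
    and "\<Omega> \<in> vf A" and "\<forall>x\<in>vf A. ip g \<Omega> x = \<theta> x"
  shows "riemannian_P_tensor A P (curvature4 A g (natural_connection n A P g nab \<Omega> lam mu)) \<longleftrightarrow>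
    (\<forall>y\<in>vf A. \<forall>z\<in>vf A. \<forall>p.
       lam * (nabla_form A nab \<theta> y z p - nabla_form A nab \<theta> z y p)
       + (mu + 1 / (2 * real n))
           * (nabla_form A nab \<theta> y (app P z) p - nabla_form A nab \<theta> z (app P y) p) = 0 \<and>
       mu * (nabla_form A nab \<theta> y z p - nabla_form A nab \<theta> z y p)
       + lam * (nabla_form A nab \<theta> y (app P z) p - nabla_form A nab \<theta> z (app P y) p) = 0)"
proof -
  interpret w1_manifold A P g nab \<Omega> n
    by unfold_locales (use assms in auto)
  show ?thesis
    unfolding natural_curvature_P_tensor_iff assms(3)
    by (intro ball_cong refl) (simp add: ext_deriv_alpha_field ext_deriv_\<Omega> ext_deriv_P\<Omega> add.commute)
qed

end
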